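(* For $|q|<1$, \begin{align*} \sum_{i,j,k\geq 0} \frac{q^{4i^2+2j^2+2k^2+4ij+4ik+2jk-j}}{(q^2;q^2)_i(q^2;q^2)_j(q^2;q^2)_k} &=\frac{1}{(q,q^4;q^5)_\infty},\\ \sum_{i,j,k\geq 0} \frac{q^{2i^2+j^2+k^2+2ij+2ik+jk}}{(q;q)_i (q;q)_j (q;q)_k}&=\frac{1}{(q,q^4;q^5)_\infty^2}, \\ \sum_{i,j,k\geq 0} \frac{q^{4i^2+2j^2+2k^2+4ij+4ik+2jk+2i+j}}{(q^2;q^2)_i(q^2;q^2)_j(q^2;q^2)_k}&=\frac{1}{(q^2,q^3;q^5)_\infty}, \\ \sum_{i,j,k\geq 0} \frac{q^{2i^2+j^2+k^2+2ij+2ik+jk+i+j}}{(q;q)_i (q;q)_j (q;q)_k}&=\frac{(q^5;q^5)_\infty}{(q;q)_\infty}, \\ \sum_{i,j,k\geq 0} \frac{q^{2i^2+j^2+k^2+2ij+2ik+jk+2i+j+k}}{(q;q)_i (q;q)_j (q;q)_k}&=\frac{1}{(q^2,q^3;q^5)_\infty^2}. \end{align*}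
   Context: For $|q|<1$: $(a;q)_n=\prod_{k=0}^{n-1}(1-aq^k)$ ($(a;q)_0=1$), $(a;q)_\infty=\prod_{k\ge0}(1-aq^k)$, $(a_1,\dots,a_m;q)_\infty=\prod_\ell(a_\ell;q)_\infty$. *)

theory Defs
  imports "HOL-Analysis.Analysis"
begin

definition qpoch :: "complex \<Rightarrow> complex \<Rightarrow> nat \<Rightarrow> complex" where
  "qpoch a q n = (\<Prod>k<n. 1 - a * q ^ k)"

definition qpoch_inf :: "complex \<Rightarrow> complex \<Rightarrow> complex" where
  "qpoch_inf a q = (\<Prod>k. 1 - a * q ^ k)"

end

theory Submission
  imports Defs
begin

text \<open>
  Write \<open>G\<close> and \<open>H\<close> for the two Rogers--Ramanujan series
  \<open>\<Sum> q^(n\<^sup>2) / (q; q)_n\<close> and \<open>\<Sum> q^(n\<^sup>2+n) / (q; q)_n\<close>.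
  In the second, fourth and fifth series, collecting the terms with \<open>i + j = a\<close>, \<open>i + k = b\<close>
  and using the expansion of \<open>1 / ((q; q)_a (q; q)_b)\<close> as
  \<open>\<Sum>i. q^((a-i)(b-i)) / ((q; q)_i (q; q)_(a-i) (q; q)_(b-i))\<close> gives \<open>G\<^sup>2\<close>, \<open>G H\<close> and \<open>H\<^sup>2\<close>.
  In the first and third series, the sum over \<open>j + k = n\<close> is a Rogers--Szego polynomial at a point where
  it factors, and the sum over \<open>2 i + n = N\<close> is the coefficient form of
  \<open>(-x; q)_\<infinity> / (x\<^sup>2; q\<^sup>2)_\<infinity> = 1 / (x; q)_\<infinity>\<close>; what remains is \<open>G\<close> and \<open>H\<close>.
  The Rogers--Ramanujan identities follow by Rogers' functional equation in the form given by Hardy and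
  Wright, restricted to arguments that are powers of \<open>q\<close>, together with the Jacobi triple product.
\<close>

section \<open>Unordered sums\<close>

text \<open>The map \<open>x \<mapsto> (g x, x)\<close> identifies the domain with the disjoint
  union of the fibres of \<open>g\<close>; since these are finite, the inner sums are ordinary
  finite sums. All later regroupings of triple series go through this.\<close>

lemma has_sum_fibres:
  fixes f :: "'a \<Rightarrow> 'c::{topological_comm_monoid_add,t3_space}"
  assumes "(f has_sum S) UNIV" and "\<And>y. finite {x. g x = y}"
  shows "((\<lambda>y. \<Sum>x | g x = y. f x) has_sum S) UNIV"
proof (rule has_sum_SigmaD)
  have "bij_betw (\<lambda>x. (g x, x)) UNIV (SIGMA y:UNIV. {x. g x = y})"
    by (rule bij_betwI[of _ _ _ snd]) auto
  from has_sum_reindex_bij_betw[OF this, of "\<lambda>(y, x). f x"]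
  show "((\<lambda>(y, x). f x) has_sum S) (SIGMA y:UNIV. {x. g x = y})"
    using assms(1) by simp
qed (use assms(2) in auto)

lemma norm_summable_on_times:
  fixes f :: "'a \<Rightarrow> complex" and g :: "'b \<Rightarrow> complex"
  assumes "(\<lambda>x. norm (f x)) summable_on A" and "(\<lambda>y. norm (g y)) summable_on B"
  shows "(\<lambda>p. norm (case p of (x, y) \<Rightarrow> f x * g y)) summable_on A \<times> B"
proof (rule summable_on_SigmaI)
  show "((\<lambda>y. norm (case (x, y) of (x, y) \<Rightarrow> f x * g y)) has_sum
          norm (f x) * infsum (\<lambda>y. norm (g y)) B) B" for x
    using has_sum_cmult_right[OF has_sum_infsum[OF assms(2)], of "norm (f x)"]
    by (simp add: norm_mult)
  show "(\<lambda>x. norm (f x) * infsum (\<lambda>y. norm (g y)) B) summable_on A"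
    by (rule summable_on_cmult_left[OF assms(1)])
qed auto

lemma has_sum_times:
  fixes f :: "'a \<Rightarrow> complex" and g :: "'b \<Rightarrow> complex"
  assumes "(\<lambda>x. norm (f x)) summable_on A" and "(\<lambda>y. norm (g y)) summable_on B"
    and "(f has_sum F) A" and "(g has_sum G) B"
  shows "((\<lambda>(x, y). f x * g y) has_sum F * G) (A \<times> B)"
proof (rule has_sum_SigmaI)
  show "((\<lambda>y. case (x, y) of (x, y) \<Rightarrow> f x * g y) has_sum f x * G) B" for x
    using has_sum_cmult_right[OF assms(4), of "f x"] by simp
  show "((\<lambda>x. f x * G) has_sum F * G) A"
    by (rule has_sum_cmult_left[OF assms(3)])
  show "(\<lambda>(x, y). f x * g y) summable_on A \<times> B"
    by (rule Infinite_Sum.abs_summable_summable[OF norm_summable_on_times[OF assms(1,2)]])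
qed

lemma norm_summable_on_nat_geometric_bound:
  fixes f :: "nat \<Rightarrow> complex"
  assumes "\<And>n. norm (f n) \<le> C * r ^ n" and "0 \<le> r" and "r < 1"
  shows "(\<lambda>n. norm (f n)) summable_on UNIV"
proof -
  have "summable (\<lambda>n. norm (f n))"
    by (rule summable_comparison_test'[of "\<lambda>n. C * r ^ n" 0])
      (use assms in \<open>auto intro: summable_mult summable_geometric\<close>)
  then show ?thesis
    by (subst summable_on_UNIV_nonneg_real_iff) auto
qed

section \<open>Convergence of q-Pochhammer products\<close>

lemma convergent_prod_qpoch:
  assumes "norm q < 1"
  shows "convergent_prod (\<lambda>k. 1 - a * q ^ k :: complex)"
proof -
  have "summable (\<lambda>k. norm (a * q ^ k))"
    using assms by (auto simp: norm_mult norm_power intro: summable_mult summable_geometric)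
  then have "abs_convergent_prod (\<lambda>k. 1 - a * q ^ k)"
    by (intro summable_imp_abs_convergent_prod) simp
  then show ?thesis
    by (rule abs_convergent_prod_imp_convergent_prod)
qed

lemma qpoch_LIMSEQ:
  assumes "norm q < 1"
  shows "qpoch a q \<longlonglongrightarrow> qpoch_inf a q"
proof -
  have "qpoch a q = (\<lambda>n. \<Prod>k<n. 1 - a * q ^ k)"
    by (simp add: qpoch_def fun_eq_iff)
  then show ?thesis
    using convergent_prod_LIMSEQ[OF convergent_prod_qpoch[OF assms, of a]]
    by (simp add: qpoch_inf_def LIMSEQ_lessThan_iff_atMost)
qed

lemma qpoch_factor_nonzero:
  assumes "norm q < 1" and "norm a < 1"
  shows "1 - a * q ^ k \<noteq> (0 :: complex)"
proof
  assume "1 - a * q ^ k = 0"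
  then have "norm a * norm q ^ k = 1"
    by (metis eq_iff_diff_eq_0 norm_mult norm_one norm_power)
  moreover have "norm a * norm q ^ k \<le> norm a * 1"
    using assms by (intro mult_left_mono power_le_one) auto
  ultimately show False
    using assms by simp
qed

lemma qpoch_nonzero:
  assumes "norm q < 1" and "norm a < 1"
  shows "qpoch a q n \<noteq> 0"
  using qpoch_factor_nonzero[OF assms] by (simp add: qpoch_def)

lemma qpoch_inf_nonzero:
  assumes "norm q < 1" and "norm a < 1"
  shows "qpoch_inf a q \<noteq> 0"
  unfolding qpoch_inf_def
  using convergent_prod_qpoch[OF assms(1)] qpoch_factor_nonzero[OF assms]
  by (rule prodinf_nonzero)

lemma qpoch_0 [simp]: "qpoch a q 0 = 1"
  by (simp add: qpoch_def)

lemma qpoch_Suc: "qpoch a q (Suc n) = qpoch a q n * (1 - a * q ^ n)"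
  by (simp add: qpoch_def)

lemma qpoch_self_Suc: "qpoch q q (Suc n) = qpoch q q n * (1 - q ^ Suc n)"
  by (simp add: qpoch_Suc)

lemma qpoch_bounded:
  assumes "norm q < 1"
  obtains C where "\<And>n. norm (qpoch a q n) \<le> C"
  using convergent_imp_Bseq[OF convergentI[OF qpoch_LIMSEQ[OF assms]]]
  by (auto simp: Bseq_def)

section \<open>Reciprocals of finite q-factorials\<close>

text \<open>With reciprocals as the basic object, the identities below need only the division-free
  relation \<open>inv_qfact_Suc\<close>.\<close>

definition inv_qfact :: "complex \<Rightarrow> nat \<Rightarrow> complex" where
  "inv_qfact q n = 1 / qpoch q q n"

lemma inv_qfact_0 [simp]: "inv_qfact q 0 = 1"
  by (simp add: inv_qfact_def)

lemma inv_qfact_Suc: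
  assumes "norm q < 1"
  shows "(1 - q ^ Suc n) * inv_qfact q (Suc n) = inv_qfact q n"
  using qpoch_nonzero[OF assms assms, of n] qpoch_nonzero[OF assms assms, of "Suc n"]
  by (simp add: inv_qfact_def qpoch_self_Suc field_simps)

lemma one_minus_power_nonzero:
  assumes "norm q < 1"
  shows "1 - q ^ Suc n \<noteq> (0 :: complex)"
  using qpoch_factor_nonzero[OF assms assms, of n] by simp

lemma inv_qfact_bounded:
  assumes "norm q < 1"
  obtains C where "\<And>n. norm (inv_qfact q n) \<le> C" and "C > 0"
proof -
  have "(\<lambda>n. inv_qfact q n) \<longlonglongrightarrow> 1 / qpoch_inf q q"
    unfolding inv_qfact_def
    by (intro tendsto_intros qpoch_LIMSEQ qpoch_inf_nonzero assms)
  from convergent_imp_Bseq[OF convergentI[OF this]] show ?thesis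
    by (auto simp: Bseq_def intro: that)
qed

section \<open>Finite convolution identities for reciprocal q-factorials\<close>

text \<open>A form of the q-Vandermonde sum, by induction on \<open>a\<close>. With
  \<open>k = a + 1 - i\<close>, the factor \<open>1 - q^(a+1)\<close> splits as
  \<open>(1 - q^k) + q^k (1 - q^i)\<close>; the first part lowers \<open>k\<close>, the second
  lowers \<open>i\<close>. After an index shift the two parts recombine to the sum for
  \<open>a\<close>.\<close>

lemma inv_qfact_mult_inv_qfact:
  assumes q: "norm q < 1"
  shows "(\<Sum>i\<le>min a b. q ^ ((a - i) * (b - i)) *
           inv_qfact q i * inv_qfact q (a - i) * inv_qfact q (b - i))
         = inv_qfact q a * inv_qfact q b"
    (is "?U a b = _")
proof (induction a)
  case 0
  then show ?case by simp
next
  case (Suc a)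
  define e where "e = inv_qfact q"
  have e: "(1 - q ^ Suc n) * e (Suc n) = e n" for n
    using inv_qfact_Suc[OF q] by (simp add: e_def)
  \<comment> \<open>The value 0 outside the range lets sums over different upper limits be
    compared.\<close>
  define t where "t a i = (if i \<le> a \<and> i \<le> b then q ^ ((a - i) * (b - i)) * e i * e (a - i) * e (b - i) else 0)"
    for a i
  have U: "?U a b = (\<Sum>i\<le>N. t a i)" if "N \<ge> a" for a N
    unfolding t_def e_def[symmetric]
    by (rule sum.mono_neutral_cong_left) (use that in auto)
  \<comment> \<open>\<open>u\<close> and \<open>v\<close> split \<open>t a\<close> according to
    \<open>1 = q^(b-i) + (1 - q^(b-i))\<close>; \<open>v'\<close> below is \<open>v\<close> moved up
    by one index, with 0 at the start.\<close>
  define u v where "u i = (if i \<le> a \<and> i \<le> b then q ^ ((a - i) * (b - i)) * q ^ (b - i) * e i * e (a - i) * e (b - i) else 0)"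
    and "v i = (if i \<le> a \<and> i \<le> b then q ^ ((a - i) * (b - i)) * (1 - q ^ (b - i)) * e i * e (a - i) * e (b - i) else 0)" for i
  define v' where "v' i = (case i of 0 \<Rightarrow> 0 | Suc l \<Rightarrow> v l)" for i
  have uv: "u i + v' i = (1 - q ^ Suc a) * t (Suc a) i" if ia: "i \<le> Suc a" for i
  proof (cases "i \<le> b")
    case False
    then show ?thesis
      by (auto simp: u_def v'_def v_def t_def split: nat.splits)
  next
    case ib: True
    obtain k where k: "Suc a = i + k" using le_Suc_ex[OF ia] by blast
    obtain d where d: "b = i + d" using le_Suc_ex[OF ib] by blast
    have u': "u i = (1 - q ^ k) * (q ^ (k * d) * e i * e k * e d)"
    proof (cases k)
      case 0
      then show ?thesis using k by (simp add: u_def)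
    next
      case (Suc k')
      then have "a = i + k'" using k by simp
      then have "u i = q ^ (k' * d) * q ^ d * e i * e k' * e d"
        using d by (simp add: u_def)
      also have "\<dots> = q ^ (k' * d) * q ^ d * e i * ((1 - q ^ k) * e k) * e d"
        using e[of k'] Suc by simp
      finally show ?thesis
        using Suc by (simp add: power_add mult_ac)
    qed
    have v'': "v' i = q ^ k * (1 - q ^ i) * (q ^ (k * d) * e i * e k * e d)"
    proof (cases i)
      case 0
      then show ?thesis by (simp add: v'_def)
    next
      case (Suc i')
      then have a: "a = i' + k" "b = i' + Suc d" using k d by auto
      have "v' i = q ^ (k * Suc d) * e i' * e k * ((1 - q ^ Suc d) * e (Suc d))"
        unfolding v'_def v_def Suc a by (simp add: mult_ac)
      also have "\<dots> = q ^ (k * Suc d) * ((1 - q ^ i) * e i) * e k * e d"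
        using e[of i'] e[of d] Suc by simp
      finally show ?thesis
        by (simp add: power_add mult_ac)
    qed
    have "u i + v' i = (1 - q ^ (i + k)) * (q ^ (k * d) * e i * e k * e d)"
      unfolding u' v'' by (simp add: power_add algebra_simps)
    then show ?thesis
      using k d by (simp add: t_def mult_ac)
  qed
  have "(1 - q ^ Suc a) * ?U (Suc a) b = (\<Sum>i\<le>Suc a. u i + v' i)"
    unfolding U[OF order_refl] sum_distrib_left by (rule sum.cong) (auto simp: uv)
  also have "\<dots> = (\<Sum>i\<le>Suc a. u i) + (\<Sum>i\<le>Suc a. v' i)"
    by (rule sum.distrib)
  also have "(\<Sum>i\<le>Suc a. u i) = (\<Sum>i\<le>a. u i)"
    by (simp add: u_def)
  also have "(\<Sum>i\<le>Suc a. v' i) = (\<Sum>i\<le>a. v i)"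
    by (subst sum.atMost_Suc_shift) (simp add: v'_def)
  also have "(\<Sum>i\<le>a. u i) + (\<Sum>i\<le>a. v i) = (\<Sum>i\<le>a. t a i)"
    unfolding sum.distrib[symmetric]
    by (rule sum.cong) (auto simp: u_def v_def t_def algebra_simps)
  also have "\<dots> = e a * e b"
    using Suc.IH U[of a a] by (simp add: e_def)
  also have "\<dots> = (1 - q ^ Suc a) * (e (Suc a) * e b)"
    using e[of a] by (simp add: mult_ac)
  finally show ?case
    using one_minus_power_nonzero[OF q, of a] by (simp add: e_def del: power_Suc)
qed

text \<open>Triangular numbers at integer arguments. They are never negative, so \<open>nat\<close>
  loses nothing, and the value can serve as a natural exponent.\<close>

definition tri :: "int \<Rightarrow> nat" where
  "tri d = nat (d * (d + 1) div 2)"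

lemma tri_double: "2 * int (tri d) = d * (d + 1)"
proof -
  have "d * (d + 1) \<ge> 0"
    by (cases "d \<ge> 0") (auto intro: mult_nonpos_nonpos)
  moreover have "even (d * (d + 1))" by simp
  ultimately show ?thesis
    unfolding tri_def by simp
qed

lemma tri_reflect: "tri (- d - 1) = tri d"
  using tri_double[of d] tri_double[of "- d - 1"] by (simp add: algebra_simps)

text \<open>Induction on \<open>n\<close>, splitting \<open>1 - q^(2n+2)\<close> as
  \<open>(1 - q^(2j)) + q^(2j) (1 - q^(2(n+1-j)))\<close>. The parts give \<open>W n\<close> and
  \<open>q^(n+1) W n\<close>, and the resulting factor \<open>1 + q^(n+1)\<close> divides
  \<open>1 - q^(2n+2)\<close>.\<close>

lemma sum_inv_qfact_square_tri:
  assumes q: "norm q < 1"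
  shows "(\<Sum>j\<le>n. q ^ tri (int n - 2 * int j) * inv_qfact (q\<^sup>2) j * inv_qfact (q\<^sup>2) (n - j)) = inv_qfact q n"
    (is "?W n = _")
proof (induction n)
  case 0
  then show ?case by (simp add: tri_def)
next
  case (Suc n)
  define E where "E = inv_qfact (q\<^sup>2)"
  have q2: "norm (q\<^sup>2) < 1"
    using q by (simp add: norm_power power_less_one_iff)
  have E: "(1 - (q\<^sup>2) ^ Suc m) * E (Suc m) = E m" for m
    unfolding E_def by (rule inv_qfact_Suc[OF q2])
  define x y where "x j = q ^ tri (int (Suc n) - 2 * int j) * ((1 - (q\<^sup>2) ^ j) * E j) * E (Suc n - j)"
    and "y j = q ^ tri (int (Suc n) - 2 * int j) * (q\<^sup>2) ^ j * E j * ((1 - (q\<^sup>2) ^ (Suc n - j)) * E (Suc n - j))" for j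
  have "(1 - (q\<^sup>2) ^ Suc n) * ?W (Suc n) = (\<Sum>j\<le>Suc n. x j + y j)"
    unfolding sum_distrib_left
  proof (rule sum.cong)
    fix j assume "j \<in> {..Suc n}"
    then have P: "(q\<^sup>2) ^ Suc n = (q\<^sup>2) ^ j * (q\<^sup>2) ^ (Suc n - j)"
      by (subst power_add[symmetric]) auto
    show "(1 - (q\<^sup>2) ^ Suc n) * (q ^ tri (int (Suc n) - 2 * int j) * inv_qfact (q\<^sup>2) j * inv_qfact (q\<^sup>2) (Suc n - j)) = x j + y j"
      unfolding x_def y_def E_def P by (simp add: algebra_simps)
  qed simp
  also have "\<dots> = (\<Sum>j\<le>n. x (Suc j)) + (\<Sum>j\<le>n. y j)"
    unfolding sum.distrib by (subst sum.atMost_Suc_shift) (simp add: x_def y_def)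
  also have "(\<Sum>j\<le>n. x (Suc j)) = ?W n"
  proof -
    \<comment> \<open>The exponent matches that of \<open>W n\<close> only after the reflection of
      \<open>j\<close> to \<open>n - j\<close>, by the symmetry of \<open>tri\<close> under
      \<open>d \<mapsto> - d - 1\<close>.\<close>
    have "(\<Sum>j\<le>n. x (Suc j)) = (\<Sum>j\<le>n. q ^ tri (int n - 2 * int (n - j)) * E (n - j) * E j)"
    proof (rule sum.cong)
      fix j assume "j \<in> {..n}"
      then have "tri (int (Suc n) - 2 * int (Suc j)) = tri (int n - 2 * int (n - j))"
        using tri_reflect[of "int n - 2 * int (n - j)"] by (simp add: of_nat_diff algebra_simps)
      then show "x (Suc j) = q ^ tri (int n - 2 * int (n - j)) * E (n - j) * E j"
        unfolding x_def E by (simp add: mult_ac)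
    qed simp
    also have "\<dots> = (\<Sum>j\<le>n. q ^ tri (int n - 2 * int j) * E j * E (n - j))"
      by (rule sum.reindex_bij_witness[of _ "\<lambda>j. n - j" "\<lambda>j. n - j"]) auto
    finally show ?thesis by (simp add: E_def)
  qed
  also have "(\<Sum>j\<le>n. y j) = q ^ Suc n * ?W n"
    unfolding sum_distrib_left
  proof (rule sum.cong)
    fix j assume "j \<in> {..n}"
    then obtain k where k: "n = j + k" using le_Suc_ex by auto
    have "tri (int (Suc n) - 2 * int j) + 2 * j = Suc n + tri (int n - 2 * int j)"
      using tri_double[of "int (Suc n) - 2 * int j"] tri_double[of "int n - 2 * int j"]
      by (simp add: k algebra_simps)
    then have "q ^ tri (int (Suc n) - 2 * int j) * (q\<^sup>2) ^ j = q ^ Suc n * q ^ tri (int n - 2 * int j)"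
      by (metis power_add power_mult)
    then show "y j = q ^ Suc n * (q ^ tri (int n - 2 * int j) * inv_qfact (q\<^sup>2) j * inv_qfact (q\<^sup>2) (n - j))"
      using E[of k] unfolding y_def E_def by (simp add: k Suc_diff_le)
  qed simp
  also have "?W n + q ^ Suc n * ?W n = (1 + q ^ Suc n) * inv_qfact q n"
    unfolding Suc.IH by (simp add: algebra_simps)
  also have "\<dots> = (1 + q ^ Suc n) * ((1 - q ^ Suc n) * inv_qfact q (Suc n))"
    by (simp only: inv_qfact_Suc[OF q])
  also have "\<dots> = (1 - (q\<^sup>2) ^ Suc n) * inv_qfact q (Suc n)"
    by (simp add: algebra_simps power2_eq_square power_mult_distrib)
  finally show ?case
    unfolding mult_left_cancel[OF one_minus_power_nonzero[OF q2, of n]] .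
qed

text \<open>Two-step induction: with \<open>M = N + 2\<close>, the splitting
  \<open>1 - q^M = (1 - q^(2i)) + q^(2i) (1 - q^(M-2i))\<close> yields
  \<open>V M (1 - q^M) = V N + q^(N+1) V (N+1)\<close>, a recurrence that \<open>inv_qfact q\<close>
  also satisfies.\<close>

lemma sum_inv_qfact_square_choose:
  assumes q: "norm q < 1"
  shows "(\<Sum>i\<le>N div 2. q ^ ((N - 2 * i) choose 2) * inv_qfact (q\<^sup>2) i * inv_qfact q (N - 2 * i)) = inv_qfact q N"
    (is "?V N = _")
proof (induction N rule: induct_nat_012)
  case 0
  then show ?case by (simp add: numeral_2_eq_2)
next
  case 1
  then show ?case by (simp add: numeral_2_eq_2)
next
  case (ge2 N)
  define e where "e = inv_qfact q"
  have e: "(1 - q ^ Suc m) * e (Suc m) = e m" for m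
    unfolding e_def by (rule inv_qfact_Suc[OF q])
  define E where "E = inv_qfact (q\<^sup>2)"
  have q2: "norm (q\<^sup>2) < 1"
    using q by (simp add: norm_power power_less_one_iff)
  have E: "(1 - (q\<^sup>2) ^ Suc m) * E (Suc m) = E m" for m
    unfolding E_def by (rule inv_qfact_Suc[OF q2])
  let ?M = "Suc (Suc N)"
  define x y where "x i = q ^ ((?M - 2 * i) choose 2) * ((1 - (q\<^sup>2) ^ i) * E i) * e (?M - 2 * i)"
    and "y i = q ^ ((?M - 2 * i) choose 2) * (q\<^sup>2) ^ i * E i * ((1 - q ^ (?M - 2 * i)) * e (?M - 2 * i))" for i
  have M2: "?M div 2 = Suc (N div 2)" by simp
  have "(1 - q ^ ?M) * ?V ?M = (\<Sum>i\<le>Suc (N div 2). x i + y i)"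
    unfolding sum_distrib_left M2
  proof (rule sum.cong)
    fix i assume "i \<in> {..Suc (N div 2)}"
    then have "2 * i + (?M - 2 * i) = ?M" by auto
    then have P: "q ^ ?M = (q\<^sup>2) ^ i * q ^ (?M - 2 * i)"
      by (metis power_add power_mult)
    show "(1 - q ^ ?M) * (q ^ ((?M - 2 * i) choose 2) * inv_qfact (q\<^sup>2) i * inv_qfact q (?M - 2 * i)) = x i + y i"
      unfolding x_def y_def E_def e_def P by (simp add: algebra_simps)
  qed simp
  also have "\<dots> = (\<Sum>i\<le>N div 2. x (Suc i)) + (\<Sum>i\<le>Suc (N div 2). y i)"
    unfolding sum.distrib by (subst sum.atMost_Suc_shift) (simp add: x_def)
  also have "(\<Sum>i\<le>N div 2. x (Suc i)) = ?V N"
    unfolding x_def E by (simp add: E_def e_def)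
  also have "(\<Sum>i\<le>Suc (N div 2). y i) = q ^ Suc N * ?V (Suc N)"
    unfolding sum_distrib_left
  proof (rule sum.mono_neutral_cong_right)
    \<comment> \<open>For even \<open>N\<close> the left range has one extra index,
      \<open>i = N/2 + 1\<close>; its term carries the factor \<open>1 - q^0 = 0\<close>.\<close>
    show "\<forall>i\<in>{..Suc (N div 2)} - {..Suc N div 2}. y i = 0"
    proof
      fix i assume "i \<in> {..Suc (N div 2)} - {..Suc N div 2}"
      then have "?M - 2 * i = 0" by auto
      then show "y i = 0" by (simp only: y_def) simp
    qed
    fix i assume "i \<in> {..Suc N div 2}"
    then have "2 * i \<le> Suc N" by auto
    then obtain n where n: "Suc N = 2 * i + n" using le_Suc_ex by blast
    then have n': "?M - 2 * i = Suc n" "Suc N - 2 * i = n" by auto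
    have "(Suc n choose 2) + 2 * i = Suc N + (n choose 2)"
      using n by (simp add: numeral_2_eq_2)
    then have "q ^ (Suc n choose 2) * (q\<^sup>2) ^ i = q ^ Suc N * q ^ (n choose 2)"
      by (metis power_add power_mult)
    then show "y i = q ^ Suc N * (q ^ ((Suc N - 2 * i) choose 2) * inv_qfact (q\<^sup>2) i * inv_qfact q (Suc N - 2 * i))"
      unfolding y_def n' e by (simp add: E_def e_def)
  qed auto
  also have "?V N + q ^ Suc N * ?V (Suc N) = e N + q ^ Suc N * e (Suc N)"
    using ge2.IH by (simp add: e_def)
  also have "\<dots> = e (Suc N)"
    using e[of N] by (simp add: algebra_simps)
  also have "\<dots> = (1 - q ^ ?M) * e ?M"
    by (rule e[symmetric])
  finally show ?case
    unfolding mult_left_cancel[OF one_minus_power_nonzero[OF q, of "Suc N"]] e_def .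
qed

section \<open>Regrouping triple series along fibres\<close>

text \<open>On the fibre \<open>i + j = a\<close>, \<open>i + k = b\<close> the weights
  \<open>c\<close> and \<open>d\<close> are constant, and the rest is
  \<open>inv_qfact_mult_inv_qfact\<close> with \<open>i\<close> as parameter. Leaving
  \<open>c\<close> and \<open>d\<close> free covers \<open>G\<^sup>2\<close>, \<open>G H\<close> and
  \<open>H\<^sup>2\<close> at once.\<close>

lemma has_sum_regroup_pair:
  assumes q: "norm q < 1"
    and "((\<lambda>(i, j, k). c (i + j) * d (i + k) * q ^ (j * k) *
            inv_qfact q i * inv_qfact q j * inv_qfact q k) has_sum S) UNIV"
  shows "((\<lambda>(a, b). (c a * inv_qfact q a) * (d b * inv_qfact q b)) has_sum S) UNIV"
proof -
  let ?f = "\<lambda>(i, j, k). c (i + j) * d (i + k) * q ^ (j * k) *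
            inv_qfact q i * inv_qfact q j * inv_qfact q k"
  let ?g = "\<lambda>(i, j, k). (i + j, i + k) :: nat \<times> nat"
  have fib: "{x. ?g x = (a, b)} = (\<lambda>i. (i, a - i, b - i)) ` {..min a b}" for a b
    by (auto simp: image_iff)
  have "finite {x. ?g x = y}" for y
    using fib by (cases y) simp
  from has_sum_fibres[OF assms(2) this] have 1: "((\<lambda>y. \<Sum>x | ?g x = y. ?f x) has_sum S) UNIV" .
  let ?h = "\<lambda>(a, b). (c a * inv_qfact q a) * (d b * inv_qfact q b)"
  have H: "(\<Sum>x | ?g x = (a, b). ?f x) = ?h (a, b)" for a b
  proof -
    have "(\<Sum>x | ?g x = (a, b). ?f x) = (\<Sum>i\<le>min a b. ?f (i, a - i, b - i))"
      unfolding fib by (subst sum.reindex) (auto simp: inj_on_def)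
    also have "\<dots> = (\<Sum>i\<le>min a b. c a * d b * (q ^ ((a - i) * (b - i)) *
           inv_qfact q i * inv_qfact q (a - i) * inv_qfact q (b - i)))"
      by (rule sum.cong) auto
    finally show ?thesis
      unfolding sum_distrib_left[symmetric] inv_qfact_mult_inv_qfact[OF q] by (simp add: mult_ac)
  qed
  have "(\<Sum>x | ?g x = y. ?f x) = ?h y" for y
    using H[of "fst y" "snd y"] by (simp only: prod.collapse)
  with 1 show ?thesis
    by simp
qed

text \<open>Two regroupings in succession: first by \<open>n = j + k\<close> with
  \<open>sum_inv_qfact_square_tri\<close>, then by \<open>N = 2 i + n\<close> with
  \<open>sum_inv_qfact_square_choose\<close>.\<close>

lemma has_sum_regroup_total:
  assumes q: "norm q < 1"
    and "((\<lambda>(i, j, k). c (2 * i + (j + k)) * q ^ ((j + k) choose 2) * q ^ tri (int k - int j) *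
            inv_qfact (q\<^sup>2) i * inv_qfact (q\<^sup>2) j * inv_qfact (q\<^sup>2) k) has_sum S) UNIV"
  shows "((\<lambda>N. c N * inv_qfact q N) has_sum S) UNIV"
proof -
  let ?f = "\<lambda>(i, j, k). c (2 * i + (j + k)) * q ^ ((j + k) choose 2) * q ^ tri (int k - int j) *
            inv_qfact (q\<^sup>2) i * inv_qfact (q\<^sup>2) j * inv_qfact (q\<^sup>2) k"
  let ?g = "\<lambda>(i, j, k). (i, j + k) :: nat \<times> nat"
  have fib: "{x. ?g x = (i, n)} = (\<lambda>j. (i, j, n - j)) ` {..n}" for i n
    by (auto simp: image_iff)
  have "finite {x. ?g x = y}" for y
    using fib by (cases y) simp
  from has_sum_fibres[OF assms(2) this] have 1: "((\<lambda>y. \<Sum>x | ?g x = y. ?f x) has_sum S) UNIV" .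
  let ?h = "\<lambda>(i, n). c (2 * i + n) * q ^ (n choose 2) * inv_qfact (q\<^sup>2) i * inv_qfact q n"
  have H: "(\<Sum>x | ?g x = (i, n). ?f x) = ?h (i, n)" for i n
  proof -
    have "(\<Sum>x | ?g x = (i, n). ?f x) = (\<Sum>j\<le>n. ?f (i, j, n - j))"
      unfolding fib by (subst sum.reindex) (auto simp: inj_on_def)
    also have "\<dots> = (\<Sum>j\<le>n. c (2 * i + n) * q ^ (n choose 2) * inv_qfact (q\<^sup>2) i *
       (q ^ tri (int n - 2 * int j) * inv_qfact (q\<^sup>2) j * inv_qfact (q\<^sup>2) (n - j)))"
      by (rule sum.cong) (auto simp: of_nat_diff)
    finally show ?thesis
      unfolding sum_distrib_left[symmetric] sum_inv_qfact_square_tri[OF q] by simp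
  qed
  have "(\<Sum>x | ?g x = y. ?f x) = ?h y" for y
    using H[of "fst y" "snd y"] by (simp only: prod.collapse)
  with 1 have 2: "(?h has_sum S) UNIV"
    by simp
  let ?g' = "\<lambda>(i, n). 2 * i + n :: nat"
  have fib': "{x. ?g' x = N} = (\<lambda>i. (i, N - 2 * i)) ` {..N div 2}" for N
    by (auto simp: image_iff)
  then have "finite {x. ?g' x = y}" for y
    by simp
  from has_sum_fibres[OF 2 this] have "((\<lambda>N. \<Sum>x | ?g' x = N. ?h x) has_sum S) UNIV" .
  moreover have "(\<Sum>x | ?g' x = N. ?h x) = c N * inv_qfact q N" for N
  proof -
    have "(\<Sum>x | ?g' x = N. ?h x) = (\<Sum>i\<le>N div 2. ?h (i, N - 2 * i))"
      unfolding fib' by (subst sum.reindex) (auto simp: inj_on_def)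
    also have "\<dots> = (\<Sum>i\<le>N div 2. c N * (q ^ ((N - 2 * i) choose 2) * inv_qfact (q\<^sup>2) i * inv_qfact q (N - 2 * i)))"
      by (rule sum.cong) auto
    finally show ?thesis
      unfolding sum_distrib_left[symmetric] sum_inv_qfact_square_choose[OF q] .
  qed
  ultimately show ?thesis
    by simp
qed

section \<open>Absolute convergence of the triple series\<close>

lemma summable_on_triple_geometric_bound:
  fixes f :: "nat \<times> nat \<times> nat \<Rightarrow> complex"
  assumes "\<And>i j k. norm (f (i, j, k)) \<le> C * r ^ (i + j + k)" and "0 \<le> r" and "r < 1"
  shows "f summable_on UNIV"
proof -
  \<comment> \<open>The majorant is a product of three geometric series, one of them carrying the
    constant.\<close>
  define g h where "g n = complex_of_real (C * r ^ n)" and "h n = complex_of_real (r ^ n)" for n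
  have g: "(\<lambda>n. norm (g n)) summable_on UNIV" and h: "(\<lambda>n. norm (h n)) summable_on UNIV"
    by (rule norm_summable_on_nat_geometric_bound[of _ "\<bar>C\<bar>" r] norm_summable_on_nat_geometric_bound[of _ 1 r];
        use assms in \<open>simp add: g_def h_def abs_mult norm_mult norm_power\<close>)+
  from norm_summable_on_times[OF g norm_summable_on_times[OF h h]]
  have "(\<lambda>p. norm (case p of (i, j, k) \<Rightarrow> g i * (h j * h k))) summable_on UNIV"
    by (simp add: case_prod_unfold)
  then have "(\<lambda>p. norm (f p)) summable_on UNIV"
  proof (rule summable_on_comparison_test)
    fix p :: "nat \<times> nat \<times> nat"
    obtain i j k where p: "p = (i, j, k)" by (cases p)
    have "norm (g i * (h j * h k)) = \<bar>C\<bar> * r ^ (i + j + k)"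
      using assms(2) by (simp add: g_def h_def norm_mult norm_power power_add abs_mult)
    moreover have "C * r ^ (i + j + k) \<le> \<bar>C\<bar> * r ^ (i + j + k)"
      using assms(2) by (intro mult_right_mono) auto
    ultimately show "norm (f p) \<le> norm (case p of (i, j, k) \<Rightarrow> g i * (h j * h k))"
      using assms(1)[of i j k] p by simp
  qed simp
  then show ?thesis
    by (rule Infinite_Sum.abs_summable_summable)
qed

text \<open>Reciprocal q-factorials are bounded, so an exponent of at least \<open>i + j + k\<close>
  gives a geometric majorant. The bases \<open>q\<close> and \<open>p\<close> are separate because
  two of the series have denominators in base \<open>q\<^sup>2\<close>.\<close>

lemma summable_on_triple_inv_qfact:
  assumes q: "norm q < 1" and p: "norm p < 1" and X: "\<And>i j k. i + j + k \<le> X i j k"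
  shows "(\<lambda>(i, j, k). q ^ X i j k * inv_qfact p i * inv_qfact p j * inv_qfact p k) summable_on UNIV"
proof -
  obtain C where C: "\<And>n. norm (inv_qfact p n) \<le> C" "C > 0"
    using inv_qfact_bounded[OF p] by blast
  show ?thesis
  proof (rule summable_on_triple_geometric_bound)
    fix i j k
    have "norm (q ^ X i j k * inv_qfact p i * inv_qfact p j * inv_qfact p k)
        \<le> norm q ^ (i + j + k) * C * C * C"
      unfolding norm_mult norm_power using C q X
      by (intro mult_mono power_decreasing) auto
    then show "norm (case (i, j, k) of (i, j, k) \<Rightarrow> q ^ X i j k * inv_qfact p i * inv_qfact p j * inv_qfact p k)
        \<le> C ^ 3 * norm q ^ (i + j + k)"
      by (simp add: power3_eq_cube mult_ac)
  qed (use q in auto)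
qed

section \<open>Euler's identities and the Jacobi triple product\<close>

text \<open>Continuity of a power series at 0; it fixes the constant after a q-difference equation
  has been iterated along \<open>z * q ^ N\<close>.\<close>

lemma powser_LIMSEQ_0:
  fixes c :: "nat \<Rightarrow> complex"
  assumes "summable (\<lambda>n. c n * K ^ n)" and "K \<noteq> 0" and "w \<longlonglongrightarrow> 0"
  shows "(\<lambda>N. \<Sum>n. c n * w N ^ n) \<longlonglongrightarrow> c 0"
proof -
  have "isCont (\<lambda>x. \<Sum>n. c n * x ^ n) 0"
    by (rule isCont_powser[OF assms(1)]) (use assms(2) in simp)
  from isCont_tendsto_compose[OF this assms(3)] show ?thesis
    by simp
qed

lemma mult_power_tendsto_0:
  fixes q :: complex
  assumes "norm q < 1"
  shows "(\<lambda>N. z * q ^ N) \<longlonglongrightarrow> 0"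
  using tendsto_mult_right_zero[OF LIMSEQ_power_zero[OF assms], of z] by simp

text \<open>The series \<open>f\<close> satisfies \<open>f (x q) = (1 - x) f x\<close>. Iteration
  gives \<open>(z; q)_N f z = f (z q^N)\<close>, whose right side tends to
  \<open>f 0 = 1\<close>.\<close>

lemma euler_sum_inverse:
  assumes q: "norm q < 1" and z: "norm z < 1"
  shows "(\<lambda>n. norm (inv_qfact q n * z ^ n)) summable_on UNIV"
    and "((\<lambda>n. inv_qfact q n * z ^ n) has_sum 1 / qpoch_inf z q) UNIV"
proof -
  obtain C where C: "\<And>n. norm (inv_qfact q n) \<le> C" "C > 0"
    using inv_qfact_bounded[OF q] by blast
  have ns: "(\<lambda>n. norm (inv_qfact q n * x ^ n)) summable_on UNIV" if "norm x < 1" for x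
    by (rule norm_summable_on_nat_geometric_bound[of _ C "norm x"])
      (use C that in \<open>auto simp: norm_mult norm_power intro!: mult_right_mono\<close>)
  then show "(\<lambda>n. norm (inv_qfact q n * z ^ n)) summable_on UNIV"
    using z by blast
  define f where "f x = (\<Sum>n. inv_qfact q n * x ^ n)" for x
  have smb: "summable (\<lambda>n. inv_qfact q n * x ^ n)" if "norm x < 1" for x
    by (rule summable_on_imp_summable[OF Infinite_Sum.abs_summable_summable[OF ns[OF that]]])
  have sums: "(\<lambda>n. inv_qfact q n * x ^ n) sums f x" if "norm x < 1" for x
    unfolding f_def using smb[OF that] by (rule summable_sums)
  have step: "f (x * q) = (1 - x) * f x" if x: "norm x < 1" for x
  proof -
    have "norm x * norm q \<le> norm x * 1"
      using q by (intro mult_left_mono) auto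
    then have xq: "norm (x * q) < 1"
      using x by (simp add: norm_mult)
    have "(\<lambda>n. inv_qfact q n * x ^ n - inv_qfact q n * (x * q) ^ n) sums (f x - f (x * q))"
      by (intro sums_diff sums x xq)
    then have "(\<lambda>n. inv_qfact q (Suc n) * x ^ Suc n - inv_qfact q (Suc n) * (x * q) ^ Suc n)
                 sums (f x - f (x * q))"
      by (subst sums_Suc_iff) simp
    moreover have "inv_qfact q (Suc n) * x ^ Suc n - inv_qfact q (Suc n) * (x * q) ^ Suc n
        = x * (inv_qfact q n * x ^ n)" for n
      by (subst inv_qfact_Suc[OF q, symmetric]) (simp add: power_mult_distrib algebra_simps)
    ultimately have "(\<lambda>n. x * (inv_qfact q n * x ^ n)) sums (f x - f (x * q))"
      by simp
    moreover have "(\<lambda>n. x * (inv_qfact q n * x ^ n)) sums (x * f x)"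
      by (intro sums_mult sums x)
    ultimately have "f x - f (x * q) = x * f x"
      by (rule sums_unique2)
    then show ?thesis by (simp add: algebra_simps)
  qed
  have zN: "norm (z * q ^ N) < 1" for N
  proof -
    have "norm z * norm q ^ N \<le> norm z * 1"
      using q by (intro mult_left_mono power_le_one) auto
    then show ?thesis using z by (simp add: norm_mult norm_power)
  qed
  have iter: "qpoch z q N * f z = f (z * q ^ N)" for N
  proof (induction N)
    case (Suc N)
    have "qpoch z q (Suc N) * f z = (1 - z * q ^ N) * (qpoch z q N * f z)"
      by (simp add: qpoch_Suc mult_ac)
    also have "\<dots> = f (z * q ^ N * q)"
      unfolding Suc.IH by (rule step[OF zN, symmetric])
    finally show ?case by (simp add: mult_ac)
  qed simp
  have "(\<lambda>N. f (z * q ^ N)) \<longlonglongrightarrow> inv_qfact q 0"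
    unfolding f_def by (rule powser_LIMSEQ_0[OF smb[of "1/2"]]) (auto intro: mult_power_tendsto_0 q)
  moreover have "(\<lambda>N. qpoch z q N * f z) \<longlonglongrightarrow> qpoch_inf z q * f z"
    by (intro tendsto_intros qpoch_LIMSEQ q)
  ultimately have "qpoch_inf z q * f z = 1"
    unfolding iter using LIMSEQ_unique by fastforce
  then have "f z = 1 / qpoch_inf z q"
    using qpoch_inf_nonzero[OF q z] by (simp add: field_simps)
  then show "((\<lambda>n. inv_qfact q n * z ^ n) has_sum 1 / qpoch_inf z q) UNIV"
    using sums[OF z] ns[OF z] by (intro norm_summable_imp_has_sum) (auto intro: summable_on_imp_summable)
qed

text \<open>The ratio of consecutive terms is \<open>r^n R\<close>, which tends to 0 however large
  \<open>R\<close> is.\<close>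

lemma summable_power_choose_two:
  fixes r R :: real
  assumes "0 \<le> r" and "r < 1" and "0 \<le> R"
  shows "summable (\<lambda>n. r ^ (n choose 2) * R ^ n)"
proof -
  have "(\<lambda>n. r ^ n * R) \<longlonglongrightarrow> 0"
    using assms by (intro tendsto_mult_left_zero LIMSEQ_power_zero) auto
  then have "eventually (\<lambda>n. r ^ n * R < 1 / 2) sequentially"
    by (rule order_tendstoD) simp
  then obtain N where N: "\<And>n. n \<ge> N \<Longrightarrow> r ^ n * R < 1 / 2"
    by (auto simp: eventually_sequentially)
  show ?thesis
  proof (rule summable_ratio_test[of "1 / 2" N])
    fix n assume n: "n \<ge> N"
    have "(r ^ n * R) * (r ^ (n choose 2) * R ^ n) \<le> (1 / 2) * (r ^ (n choose 2) * R ^ n)"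
      using N[OF n] assms by (intro mult_right_mono) auto
    moreover have "r ^ (Suc n choose 2) * R ^ Suc n = (r ^ n * R) * (r ^ (n choose 2) * R ^ n)"
      by (simp add: numeral_2_eq_2 power_add mult_ac)
    moreover have "norm (r ^ k * R ^ m) = r ^ k * R ^ m" for k m
      using assms by simp
    ultimately show "norm (r ^ (Suc n choose 2) * R ^ Suc n) \<le> 1 / 2 * norm (r ^ (n choose 2) * R ^ n)"
      by metis
  qed simp
qed

text \<open>Iteration of \<open>g x = (1 - x) g (x q)\<close>. The series is entire, so
  \<open>z\<close> is arbitrary; the triple product uses it at negative powers of the base.\<close>

lemma euler_sum_product:
  assumes q: "norm q < 1"
  shows "((\<lambda>n. (-1) ^ n * q ^ (n choose 2) * inv_qfact q n * z ^ n) has_sum qpoch_inf z q) UNIV"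
proof -
  define c where "c n = (-1) ^ n * q ^ (n choose 2) * inv_qfact q n" for n
  obtain C where C: "\<And>n. norm (inv_qfact q n) \<le> C" "C > 0"
    using inv_qfact_bounded[OF q] by blast
  have ns: "summable (\<lambda>n. norm (c n * x ^ n))" for x
  proof (rule summable_comparison_test'[of "\<lambda>n. C * (norm q ^ (n choose 2) * norm x ^ n)" 0])
    show "summable (\<lambda>n. C * (norm q ^ (n choose 2) * norm x ^ n))"
      using q by (intro summable_mult summable_power_choose_two) auto
    show "norm (norm (c n * x ^ n)) \<le> C * (norm q ^ (n choose 2) * norm x ^ n)" for n
      using mult_right_mono[OF C(1)[of n], of "norm q ^ (n choose 2) * norm x ^ n"]
      by (simp add: c_def norm_mult norm_power mult_ac)
  qed
  define g where "g x = (\<Sum>n. c n * x ^ n)" for x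
  have sums: "(\<lambda>n. c n * x ^ n) sums g x" for x
    unfolding g_def by (rule summable_sums[OF summable_norm_cancel[OF ns]])
  have step: "g x = (1 - x) * g (x * q)" for x
  proof -
    have "(\<lambda>n. c n * x ^ n - c n * (x * q) ^ n) sums (g x - g (x * q))"
      by (intro sums_diff sums)
    then have "(\<lambda>n. c (Suc n) * x ^ Suc n - c (Suc n) * (x * q) ^ Suc n) sums (g x - g (x * q))"
      by (subst sums_Suc_iff) simp
    moreover have "c (Suc n) * x ^ Suc n - c (Suc n) * (x * q) ^ Suc n = - x * (c n * (x * q) ^ n)" for n
    proof -
      have c_n: "c n = (-1) ^ n * q ^ (n choose 2) * ((1 - q ^ Suc n) * inv_qfact q (Suc n))"
        unfolding c_def inv_qfact_Suc[OF q] ..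
      have "c (Suc n) = - ((-1) ^ n * q ^ (n choose 2) * q ^ n * inv_qfact q (Suc n))"
        unfolding c_def by (simp add: numeral_2_eq_2 power_add mult_ac)
      then show ?thesis
        unfolding c_n by (simp add: power_mult_distrib algebra_simps)
    qed
    ultimately have "(\<lambda>n. - x * (c n * (x * q) ^ n)) sums (g x - g (x * q))"
      by simp
    moreover have "(\<lambda>n. - x * (c n * (x * q) ^ n)) sums (- x * g (x * q))"
      by (intro sums_mult sums)
    ultimately have "g x - g (x * q) = - x * g (x * q)"
      by (rule sums_unique2)
    then show ?thesis by (simp add: algebra_simps)
  qed
  have iter: "qpoch z q N * g (z * q ^ N) = g z" for N
  proof (induction N)
    case (Suc N)
    have "qpoch z q (Suc N) * g (z * q ^ Suc N) = qpoch z q N * ((1 - z * q ^ N) * g (z * q ^ N * q))"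
      by (simp add: qpoch_Suc mult_ac)
    also have "\<dots> = g z"
      unfolding step[symmetric] by (rule Suc.IH)
    finally show ?case .
  qed simp
  have "(\<lambda>N. g (z * q ^ N)) \<longlonglongrightarrow> c 0"
    unfolding g_def
    by (rule powser_LIMSEQ_0[OF summable_norm_cancel[OF ns[of 1]]]) (auto intro: mult_power_tendsto_0 q)
  then have "(\<lambda>N. qpoch z q N * g (z * q ^ N)) \<longlonglongrightarrow> qpoch_inf z q * c 0"
    by (intro tendsto_intros qpoch_LIMSEQ q)
  then have "g z = qpoch_inf z q"
    unfolding iter by (simp add: LIMSEQ_const_iff c_def numeral_2_eq_2)
  then show ?thesis
    using norm_summable_imp_has_sum[OF ns sums, of z] by (simp add: c_def)
qed

section \<open>Bilateral sums and the triple product\<close>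

lemma has_sum_int:
  fixes f :: "int \<Rightarrow> 'a :: topological_comm_monoid_add"
  assumes "((\<lambda>n. f (int n)) has_sum a) UNIV" and "((\<lambda>n. f (- int n - 1)) has_sum b) UNIV"
  shows "(f has_sum (a + b)) UNIV"
proof -
  have "bij_betw int UNIV {0..}"
    by (rule bij_betwI[of _ _ _ nat]) auto
  then have 1: "(f has_sum a) {0..}"
    using has_sum_reindex_bij_betw[of int UNIV "{0..}" f a] assms(1) by simp
  have "bij_betw (\<lambda>n. - int n - 1) UNIV {..<0}"
    by (rule bij_betwI[of _ _ _ "\<lambda>m. nat (- m - 1)"]) auto
  then have 2: "(f has_sum b) {..<0}"
    using has_sum_reindex_bij_betw[of "\<lambda>n. - int n - 1" UNIV "{..<0}" f b] assms(2) by simp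
  have "{0..} \<union> {..<0} = (UNIV :: int set)" and "{0..} \<inter> {..<0} = ({} :: int set)"
    by auto
  then show ?thesis
    using has_sum_Un_disjoint[OF 1 2] by simp
qed

lemma tri_pred_of_nat: "tri (int n - 1) = n choose 2"
proof (induction n)
  case 0
  then show ?case by (simp add: tri_def numeral_2_eq_2)
next
  case (Suc n)
  have "tri (int n) = tri (int n - 1) + n"
    using tri_double[of "int n"] tri_double[of "int n - 1"] by (simp add: algebra_simps)
  then show ?case using Suc by (simp add: numeral_2_eq_2)
qed

lemma qpoch_inf_power_Suc:
  assumes q: "norm q < 1"
  shows "qpoch_inf (q ^ Suc n) q = qpoch_inf q q * inv_qfact q n"
proof -
  have eq: "qpoch q q (m + n) = qpoch q q n * qpoch (q ^ Suc n) q m" for m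
    by (induction m) (simp_all add: qpoch_Suc power_add mult_ac)
  have "(\<lambda>m. qpoch q q (m + n)) \<longlonglongrightarrow> qpoch_inf q q"
    by (rule LIMSEQ_ignore_initial_segment[OF qpoch_LIMSEQ[OF q]])
  moreover have "(\<lambda>m. qpoch q q n * qpoch (q ^ Suc n) q m) \<longlonglongrightarrow> qpoch q q n * qpoch_inf (q ^ Suc n) q"
    by (intro tendsto_intros qpoch_LIMSEQ q)
  ultimately have "qpoch_inf q q = qpoch q q n * qpoch_inf (q ^ Suc n) q"
    unfolding eq by (rule LIMSEQ_unique)
  then show ?thesis
    using qpoch_nonzero[OF q q, of n] by (simp add: inv_qfact_def)
qed

text \<open>The factor of index \<open>n\<close> is \<open>1 - q^(-n) q^n = 0\<close>.\<close>

lemma qpoch_inf_negative_power: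
  assumes q: "norm q < 1" and "q \<noteq> 0"
  shows "qpoch_inf (q powi (- int n)) q = 0"
proof -
  have "qpoch (q powi (- int n)) q m = 0" if "m \<ge> Suc n" for m
  proof -
    have "1 - q powi (- int n) * q ^ n = 0"
      using assms(2) by (simp add: power_int_minus)
    then show ?thesis
      unfolding qpoch_def using that by (intro prod_zero) auto
  qed
  then have "qpoch (q powi (- int n)) q \<longlonglongrightarrow> 0"
    by (intro tendsto_eventually) (auto simp: eventually_sequentially)
  with qpoch_LIMSEQ[OF q] show ?thesis
    by (rule LIMSEQ_unique)
qed

text \<open>
  Andrews' argument: the product of the theta series in \<open>z\<close> with Euler's series for
  \<open>1 / (w; p)\<close> is re-indexed by \<open>(n, m) \<mapsto> (n + m, m)\<close>; the inner sums
  over \<open>m\<close> are then Euler products \<open>(p^(n+1); p)\<close>, which vanish for \<open>n < 0\<close>.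
  The bilateral series is folded into a series over the natural numbers.
\<close>

lemma jacobi_triple_product:
  assumes p: "norm p < 1" "p \<noteq> 0" and zw: "z * w = p" and z: "norm z < 1" and w: "norm w < 1"
  shows "((\<lambda>n. (-1) ^ n * p ^ (n choose 2) * (z ^ n - p ^ n * w ^ Suc n)) has_sum
           (qpoch_inf z p * qpoch_inf w p * qpoch_inf p p)) UNIV"
proof -
  have nz: "z \<noteq> 0" "w \<noteq> 0" using zw p by auto
  define T where "T n = (-1) powi n * p ^ tri (n - 1) * z powi n" for n
  have T_nat: "T (int n) = (-1) ^ n * p ^ (n choose 2) * z ^ n" for n
    unfolding T_def tri_pred_of_nat by simp
  \<comment> \<open>The triangular exponent here is \<open>(n choose 2) + n + (n + 1)\<close>; the
    surplus \<open>p^(n+1)\<close> turns \<open>z^(-n-1)\<close> into \<open>w^(n+1)\<close>,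
    because \<open>p = z w\<close>.\<close>
  have T_neg: "T (- int n - 1) = - ((-1) ^ n * p ^ (n choose 2) * p ^ n * w ^ Suc n)" for n
  proof -
    have "tri (- int n - 1 - 1) = (n choose 2) + n + Suc n"
      using tri_reflect[of "int (Suc (Suc n)) - 1"] tri_pred_of_nat[of "Suc (Suc n)"]
      by (simp add: numeral_2_eq_2)
    moreover have powi: "x powi (- int n - 1) = inverse (x ^ Suc n)" for x :: complex
    proof -
      have "- int n - 1 = - int (Suc n)" by simp
      then show ?thesis by (simp only: power_int_minus power_int_of_nat)
    qed
    moreover have "(-1) powi (- int n - 1) = - ((-1) ^ n :: complex)"
      unfolding powi by (cases "even n") auto
    moreover have "p ^ Suc n * inverse (z ^ Suc n) = w ^ Suc n"
      using nz unfolding zw[symmetric] power_mult_distrib by (simp add: field_simps)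
    ultimately show ?thesis
      unfolding T_def by (simp add: power_add mult_ac)
  qed
  have norm_z: "norm (T (int n)) \<le> 1 * norm z ^ n" for n
    unfolding T_nat norm_mult norm_power using p
    by (intro mult_right_mono) (auto intro: power_le_one)
  have norm_w: "norm (T (- int n - 1)) \<le> 1 * norm w ^ n" for n
  proof -
    have "norm p ^ (n choose 2) * norm p ^ n * norm w \<le> 1 * 1 * 1"
      using p w by (intro mult_mono power_le_one) auto
    then have "norm p ^ (n choose 2) * norm p ^ n * norm w * norm w ^ n \<le> 1 * norm w ^ n"
      by (intro mult_right_mono) auto
    then show ?thesis
      unfolding T_neg by (simp add: norm_mult norm_power mult_ac)
  qed
  have ns_nat: "(\<lambda>n. norm (T (int n))) summable_on UNIV"
    by (rule norm_summable_on_nat_geometric_bound[OF norm_z]) (use z in auto)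
  have ns_neg: "(\<lambda>n. norm (T (- int n - 1))) summable_on UNIV"
    by (rule norm_summable_on_nat_geometric_bound[OF norm_w]) (use w in auto)
  have ns: "(\<lambda>n. norm (T n)) summable_on UNIV"
    using has_sum_int[OF has_sum_infsum[OF ns_nat] has_sum_infsum[OF ns_neg]]
    by (rule has_sum_imp_summable)
  define S where "S = infsum T UNIV"
  have S: "(T has_sum S) UNIV"
    unfolding S_def using Infinite_Sum.abs_summable_summable[OF ns] by simp
  define e where "e = inv_qfact p"
  have "((\<lambda>(n, m). T n * (e m * w ^ m)) has_sum S * (1 / qpoch_inf w p)) (UNIV \<times> UNIV)"
    unfolding e_def by (rule has_sum_times[OF ns euler_sum_inverse(1)[OF p(1) w] S euler_sum_inverse(2)[OF p(1) w]])
  moreover have "bij_betw (\<lambda>(n, m). (n + int m, m)) (UNIV \<times> UNIV) (UNIV \<times> UNIV)"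
    by (rule bij_betwI[of _ _ _ "\<lambda>(n, m). (n - int m, m)"]) auto
  ultimately have shifted: "((\<lambda>(n, m). T (n + int m) * (e m * w ^ m)) has_sum S * (1 / qpoch_inf w p)) (UNIV \<times> UNIV)"
    using has_sum_reindex_bij_betw[of "\<lambda>(n, m). (n + int m, m)" "UNIV \<times> UNIV" "UNIV \<times> UNIV"
        "\<lambda>(n, m). T n * (e m * w ^ m)"] by (simp add: case_prod_unfold)
  \<comment> \<open>Shifting by \<open>m\<close> contributes \<open>p^(n m)\<close>, and
    \<open>(z w)^m = p^m\<close> contributes one more factor \<open>p\<close> per step; hence
    Euler's product is taken at \<open>p^(n+1)\<close>.\<close>
  have T_add: "T (n + int m) * (e m * w ^ m) =
      T n * ((-1) ^ m * p ^ (m choose 2) * e m * (p powi (n + 1)) ^ m)" for n m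
  proof -
    have "int (tri (n + int m - 1) + m) = int (tri (n - 1)) + int (m choose 2) + (n + 1) * int m"
      using tri_double[of "n + int m - 1"] tri_double[of "n - 1"] tri_double[of "int m - 1"]
      unfolding tri_pred_of_nat by (simp add: algebra_simps)
    then have "p powi int (tri (n + int m - 1) + m) = p powi (int (tri (n - 1)) + int (m choose 2) + (n + 1) * int m)"
      by (rule arg_cong)
    then have P: "p ^ tri (n + int m - 1) * p ^ m = p ^ tri (n - 1) * p ^ (m choose 2) * (p powi (n + 1)) ^ m"
      using p(2) by (simp add: power_int_add power_int_mult power_add del: of_nat_add)
    have "T (n + int m) * (e m * w ^ m) =
        (-1) powi n * (-1) ^ m * p ^ tri (n + int m - 1) * z powi n * (z * w) ^ m * e m"
      unfolding T_def using nz by (simp add: power_int_add power_mult_distrib mult_ac)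
    also have "\<dots> = (-1) powi n * (-1) ^ m * z powi n * e m * (p ^ tri (n + int m - 1) * p ^ m)"
      unfolding zw by (simp add: mult_ac)
    finally show ?thesis
      unfolding P T_def by (simp add: mult_ac)
  qed
  have "((\<lambda>n. T n * qpoch_inf (p powi (n + 1)) p) has_sum S * (1 / qpoch_inf w p)) UNIV"
  proof (rule has_sum_SigmaD[OF shifted])
    fix n
    show "((\<lambda>m. case (n, m) of (n, m) \<Rightarrow> T (n + int m) * (e m * w ^ m)) has_sum
            T n * qpoch_inf (p powi (n + 1)) p) UNIV"
      unfolding prod.case T_add unfolding e_def
      by (rule has_sum_cmult_right[OF euler_sum_product[OF p(1)]])
  qed
  moreover have "((\<lambda>n. T n * qpoch_inf (p powi (n + 1)) p) has_sum (qpoch_inf p p * qpoch_inf z p + 0)) UNIV"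
  proof (rule has_sum_int)
    have "T (int n) * qpoch_inf (p powi (int n + 1)) p =
        qpoch_inf p p * ((-1) ^ n * p ^ (n choose 2) * inv_qfact p n * z ^ n)" for n
    proof -
      have "p powi (int n + 1) = p ^ Suc n"
        using power_int_of_nat[of p "Suc n"] by (simp add: algebra_simps)
      then show ?thesis
        unfolding T_nat by (simp add: qpoch_inf_power_Suc[OF p(1)] mult_ac del: power_Suc)
    qed
    then show "((\<lambda>n. T (int n) * qpoch_inf (p powi (int n + 1)) p) has_sum qpoch_inf p p * qpoch_inf z p) UNIV"
      using has_sum_cmult_right[OF euler_sum_product[OF p(1)]] by simp
    show "((\<lambda>n. T (- int n - 1) * qpoch_inf (p powi (- int n - 1 + 1)) p) has_sum 0) UNIV"
      using qpoch_inf_negative_power[OF p] by simp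
  qed
  ultimately have "S * (1 / qpoch_inf w p) = qpoch_inf p p * qpoch_inf z p + 0"
    by (rule has_sum_unique)
  then have S_eq: "S = qpoch_inf z p * qpoch_inf w p * qpoch_inf p p"
    using qpoch_inf_nonzero[OF p(1) w] by (simp add: field_simps)
  have nat: "((\<lambda>n. T (int n)) has_sum infsum (\<lambda>n. T (int n)) UNIV) UNIV"
    by (rule has_sum_infsum[OF Infinite_Sum.abs_summable_summable[OF ns_nat]])
  have neg: "((\<lambda>n. T (- int n - 1)) has_sum infsum (\<lambda>n. T (- int n - 1)) UNIV) UNIV"
    by (rule has_sum_infsum[OF Infinite_Sum.abs_summable_summable[OF ns_neg]])
  have "infsum (\<lambda>n. T (int n)) UNIV + infsum (\<lambda>n. T (- int n - 1)) UNIV = S"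
    by (rule has_sum_unique[OF has_sum_int[OF nat neg] S])
  with has_sum_add[OF nat neg] have "((\<lambda>n. T (int n) + T (- int n - 1)) has_sum S) UNIV"
    by simp
  moreover have "T (int n) + T (- int n - 1) = (-1) ^ n * p ^ (n choose 2) * (z ^ n - p ^ n * w ^ Suc n)" for n
    unfolding T_nat T_neg by (simp add: algebra_simps)
  ultimately show ?thesis
    unfolding S_eq by simp
qed

section \<open>The Rogers--Ramanujan identities\<close>

text \<open>The maximum of two consecutive norms grows by at most the factor \<open>1 + r^M\<close>
  on going from \<open>M + 1\<close> down to \<open>M\<close>. The product of these factors stays
  bounded, so a solution tending to 0 at infinity vanishes everywhere.\<close>

lemma rr_recurrence_unique:
  fixes d :: "nat \<Rightarrow> complex"
  assumes q: "norm q < 1" and rec: "\<And>M. d M = d (Suc M) + q ^ Suc M * d (Suc (Suc M))" and "d \<longlonglongrightarrow> 0"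
  shows "d M = 0"
proof -
  define r where "r = norm q"
  have r: "0 \<le> r" "r < 1" using q by (auto simp: r_def)
  define \<mu> where "\<mu> M = max (norm (d M)) (norm (d (Suc M)))" for M
  have \<mu>: "\<mu> M \<ge> 0" for M by (simp add: \<mu>_def le_max_iff_disj)
  have step: "\<mu> M \<le> (1 + r ^ M) * \<mu> (Suc M)" for M
  proof -
    have "norm (d M) \<le> norm (d (Suc M)) + norm (q ^ Suc M * d (Suc (Suc M)))"
      by (subst rec) (rule norm_triangle_ineq)
    also have "norm (q ^ Suc M * d (Suc (Suc M))) = r ^ Suc M * norm (d (Suc (Suc M)))"
      by (simp add: r_def norm_mult norm_power)
    also have "norm (d (Suc M)) + r ^ Suc M * norm (d (Suc (Suc M))) \<le> \<mu> (Suc M) + r ^ M * \<mu> (Suc M)"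
      by (intro add_mono mult_mono power_decreasing) (use r in \<open>auto simp: \<mu>_def\<close>)
    finally have "norm (d M) \<le> (1 + r ^ M) * \<mu> (Suc M)"
      by (simp add: algebra_simps)
    moreover have "norm (d (Suc M)) \<le> (1 + r ^ M) * \<mu> (Suc M)"
    proof -
      have "norm (d (Suc M)) \<le> 1 * \<mu> (Suc M)" by (simp add: \<mu>_def)
      also have "\<dots> \<le> (1 + r ^ M) * \<mu> (Suc M)"
        using \<mu> r by (intro mult_right_mono) auto
      finally show ?thesis .
    qed
    ultimately show ?thesis by (simp add: \<mu>_def)
  qed
  have iter: "\<mu> M \<le> (\<Prod>k<N. 1 + r ^ (M + k)) * \<mu> (M + N)" for N
  proof (induction N)
    case (Suc N)
    have "\<mu> M \<le> (\<Prod>k<N. 1 + r ^ (M + k)) * \<mu> (M + N)" by (rule Suc.IH)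
    also have "\<dots> \<le> (\<Prod>k<N. 1 + r ^ (M + k)) * ((1 + r ^ (M + N)) * \<mu> (Suc (M + N)))"
      using r by (intro mult_left_mono step prod_nonneg) (auto intro: add_nonneg_nonneg)
    finally show ?case by (simp add: mult_ac)
  qed simp
  have bound: "(\<Prod>k<N. 1 + r ^ (M + k)) \<le> exp (1 / (1 - r))" for N
  proof -
    have "(\<Prod>k<N. 1 + r ^ (M + k)) \<le> exp (\<Sum>k<N. r ^ (M + k))"
      using r by (intro prod_le_exp_sum) auto
    also have "(\<Sum>k<N. r ^ (M + k)) \<le> (\<Sum>k<N. r ^ k)"
      using r by (intro sum_mono power_decreasing) auto
    also have "\<dots> \<le> (\<Sum>k. r ^ k)"
      using r by (intro sum_le_suminf summable_geometric) auto
    also have "\<dots> = 1 / (1 - r)"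
      using r by (simp add: suminf_geometric)
    finally show ?thesis by simp
  qed
  have le: "\<mu> M \<le> exp (1 / (1 - r)) * \<mu> (M + N)" for N
    using iter[of N] mult_right_mono[OF bound[of N] \<mu>[of "M + N"]] by linarith
  have "(\<lambda>N. norm (d N)) \<longlonglongrightarrow> 0"
    using assms(3) by (rule tendsto_norm_zero)
  then have "\<mu> \<longlonglongrightarrow> max 0 0"
    unfolding \<mu>_def by (intro tendsto_max LIMSEQ_Suc)
  then have "(\<lambda>N. \<mu> (M + N)) \<longlonglongrightarrow> 0"
    using LIMSEQ_ignore_initial_segment[of \<mu> 0 M] by (simp add: add.commute)
  then have "(\<lambda>N. exp (1 / (1 - r)) * \<mu> (M + N)) \<longlonglongrightarrow> exp (1 / (1 - r)) * 0"
    by (intro tendsto_intros)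
  then have "\<mu> M \<le> exp (1 / (1 - r)) * 0"
    by (rule LIMSEQ_le_const) (use le in auto)
  then have "norm (d M) \<le> 0"
    by (simp add: \<mu>_def)
  then show ?thesis by simp
qed

text \<open>Lets one half of a split summand move by one index; convergence of that half follows by
  subtracting \<open>A\<close> from the whole.\<close>

lemma sums_shift_second:
  fixes A B :: "nat \<Rightarrow> complex"
  assumes "(\<lambda>r. A r + B r) sums s" and "summable A" and "B 0 = 0"
  shows "(\<lambda>r. A r + B (Suc r)) sums s"
proof -
  have A: "A sums suminf A"
    using assms(2) by (rule summable_sums)
  have "B sums (s - suminf A)"
    using sums_diff[OF assms(1) A] by simp
  then have "(\<lambda>r. B (Suc r)) sums (s - suminf A)"
    by (subst sums_Suc_iff) (simp add: assms(3))
  from sums_add[OF A this] show ?thesis by simp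
qed

text \<open>Rogers' function \<open>\<Sum> q^(m\<^sup>2) x^m / (q; q)_m\<close> at
  \<open>x = q^n\<close>; the values at \<open>n = 0\<close> and \<open>n = 1\<close> are
  \<open>G\<close> and \<open>H\<close>.\<close>

definition rr_series :: "complex \<Rightarrow> nat \<Rightarrow> complex" where
  "rr_series q n = (\<Sum>m. q ^ m\<^sup>2 * inv_qfact q m * (q ^ n) ^ m)"

lemma norm_one_minus_le_2: "norm x \<le> 1 \<Longrightarrow> norm (1 - x :: complex) \<le> 2"
  using norm_triangle_ineq4[of 1 x] by simp

context
  fixes q :: complex
  assumes q: "norm q < 1"
begin

lemma rr_series_norm_summable:
  "summable (\<lambda>m. norm (q ^ m\<^sup>2 * inv_qfact q m * (q ^ n) ^ m))"
proof -
  obtain C where C: "\<And>n. norm (inv_qfact q n) \<le> C" "C > 0"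
    using inv_qfact_bounded[OF q] by blast
  show ?thesis
  proof (rule summable_comparison_test'[of "\<lambda>m. C * norm q ^ m" 0])
    show "summable (\<lambda>m. C * norm q ^ m)"
      using q by (intro summable_mult summable_geometric) auto
    fix m
    have "norm q ^ m\<^sup>2 * norm (inv_qfact q m) * (norm q ^ n) ^ m \<le> norm q ^ m * C * 1"
      using q C by (intro mult_mono power_decreasing power_le_one) (auto simp: power2_eq_square)
    then show "norm (norm (q ^ m\<^sup>2 * inv_qfact q m * (q ^ n) ^ m)) \<le> C * norm q ^ m"
      by (simp add: norm_mult norm_power mult_ac)
  qed
qed

lemma rr_series_sums: "(\<lambda>m. q ^ m\<^sup>2 * inv_qfact q m * (q ^ n) ^ m) sums rr_series q n"
  unfolding rr_series_def
  by (rule summable_sums[OF summable_norm_cancel[OF rr_series_norm_summable]])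

lemma rr_series_has_sum: "((\<lambda>m. q ^ m\<^sup>2 * inv_qfact q m * (q ^ n) ^ m) has_sum rr_series q n) UNIV"
  by (rule norm_summable_imp_has_sum[OF rr_series_norm_summable rr_series_sums])

text \<open>Subtracting termwise produces \<open>1 - q^m\<close>, which cancels the last factor of
  \<open>(q; q)_m\<close>; then \<open>(m+1)\<^sup>2 = m\<^sup>2 + 2 m + 1\<close> raises the
  argument by two powers of \<open>q\<close>.\<close>

lemma rr_series_rec: "rr_series q n = rr_series q (Suc n) + q ^ Suc n * rr_series q (Suc (Suc n))"
proof -
  let ?t = "\<lambda>n m. q ^ m\<^sup>2 * inv_qfact q m * (q ^ n) ^ m"
  have "(\<lambda>m. ?t n m - ?t (Suc n) m) sums (rr_series q n - rr_series q (Suc n))"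
    by (intro sums_diff rr_series_sums)
  then have "(\<lambda>m. ?t n (Suc m) - ?t (Suc n) (Suc m)) sums (rr_series q n - rr_series q (Suc n))"
    by (subst sums_Suc_iff) simp
  moreover have "?t n (Suc m) - ?t (Suc n) (Suc m) = q ^ Suc n * ?t (Suc (Suc n)) m" for m
  proof -
    have sq: "q ^ (Suc m)\<^sup>2 = q ^ m\<^sup>2 * q ^ m * q ^ m * q"
      unfolding power2_eq_square by (simp add: power_add mult_ac)
    have "?t n (Suc m) - ?t (Suc n) (Suc m) =
      q ^ (Suc m)\<^sup>2 * (q ^ n) ^ Suc m * ((1 - q ^ Suc m) * inv_qfact q (Suc m))"
      by (simp add: power_mult_distrib algebra_simps)
    then show ?thesis
      unfolding inv_qfact_Suc[OF q] sq by (simp add: power_mult_distrib mult_ac)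
  qed
  ultimately have "(\<lambda>m. q ^ Suc n * ?t (Suc (Suc n)) m) sums (rr_series q n - rr_series q (Suc n))"
    by simp
  from sums_unique2[OF this sums_mult[OF rr_series_sums]] show ?thesis
    by (simp add: algebra_simps)
qed

lemma rr_series_LIMSEQ: "rr_series q \<longlonglongrightarrow> 1"
proof -
  have "(\<lambda>n. \<Sum>m. q ^ m\<^sup>2 * inv_qfact q m * (1 * q ^ n) ^ m) \<longlonglongrightarrow> q ^ 0\<^sup>2 * inv_qfact q 0"
  proof (rule powser_LIMSEQ_0)
    show "summable (\<lambda>m. q ^ m\<^sup>2 * inv_qfact q m * 1 ^ m)"
      using summable_norm_cancel[OF rr_series_norm_summable[of 0]] by simp
    show "(\<lambda>n. 1 * q ^ n) \<longlonglongrightarrow> 0"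
      by (rule mult_power_tendsto_0[OF q])
  qed simp
  then show ?thesis by (simp add: rr_series_def[abs_def])
qed

section \<open>Auxiliary series solving the same recurrence\<close>

text \<open>
  With \<open>a = q^(M+1)\<close>, these are the summands of the auxiliary series \<open>H_1(a)\<close> and
  \<open>H_2(a)\<close> of Hardy and Wright, multiplied by \<open>(q; q)_\<infinity>\<close>.
\<close>

definition hw1 :: "nat \<Rightarrow> nat \<Rightarrow> complex" where
  "hw1 M r = (-1) ^ r * q ^ (5 * (r choose 2)) * (q ^ r) ^ 4 * (q ^ M) ^ (2 * r) *
     (1 - q * q ^ M * (q ^ r)\<^sup>2) * qpoch q q (M + r) * inv_qfact q r"

definition hw2 :: "nat \<Rightarrow> nat \<Rightarrow> complex" where
  "hw2 M r = (-1) ^ r * q ^ (5 * (r choose 2)) * (q ^ r) ^ 3 * (q ^ M) ^ (2 * r) *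
     (1 - (q * q ^ M * (q ^ r)\<^sup>2)\<^sup>2) * qpoch q q (M + r) * inv_qfact q r"

text \<open>The free parameters cover both auxiliary series and the pieces they are split into. The
  bound is uniform in \<open>M\<close>, so it also dominates the limit in \<open>M\<close>.\<close>

lemma hw_bound:
  obtains C where "\<And>k m r x M N. k > 0 \<Longrightarrow> norm x \<le> 2 \<Longrightarrow>
    norm ((-1) ^ r * q ^ m * (q ^ r) ^ k * (q ^ M) ^ (2 * r) * x * qpoch q q N * inv_qfact q r) \<le> C * norm q ^ r"
proof -
  obtain C where C: "\<And>n. norm (inv_qfact q n) \<le> C" "C > 0"
    using inv_qfact_bounded[OF q] by blast
  obtain D where D: "\<And>n. norm (qpoch q q n) \<le> D"
    using qpoch_bounded[OF q] by blast
  have "D \<ge> 0" using D[of 0] norm_ge_zero order_trans by blast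
  have "norm ((-1) ^ r * q ^ m * (q ^ r) ^ k * (q ^ M) ^ (2 * r) * x * qpoch q q N * inv_qfact q r) \<le> (2 * D * C) * norm q ^ r"
    if "k > 0" "norm x \<le> 2" for k m r x M N
  proof -
    have "(norm q ^ r) ^ k \<le> norm q ^ r"
      unfolding power_mult[symmetric] using q that by (intro power_decreasing) auto
    then have "1 * norm q ^ m * (norm q ^ r) ^ k * (norm q ^ M) ^ (2 * r) * norm x * norm (qpoch q q N) * norm (inv_qfact q r)
        \<le> 1 * 1 * norm q ^ r * 1 * 2 * D * C"
      using q that C D \<open>D \<ge> 0\<close> by (intro mult_mono power_le_one) auto
    then show ?thesis
      by (simp add: norm_mult norm_power mult_ac)
  qed
  then show ?thesis by (rule that)
qed

lemma summable_hw:
  assumes "\<And>r. norm (x r) \<le> 2" and "k > 0"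
  shows "summable (\<lambda>r. (-1) ^ r * q ^ m r * (q ^ r) ^ k * (q ^ M) ^ (2 * r) * x r * qpoch q q (N r) * inv_qfact q r)"
proof -
  obtain C where C: "\<And>k m r x M N. k > 0 \<Longrightarrow> norm x \<le> 2 \<Longrightarrow>
    norm ((-1) ^ r * q ^ m * (q ^ r) ^ k * (q ^ M) ^ (2 * r) * x * qpoch q q N * inv_qfact q r) \<le> C * norm q ^ r"
    using hw_bound by blast
  show ?thesis
    by (rule summable_comparison_test'[of "\<lambda>r. C * norm q ^ r" 0])
      (use C assms q in \<open>auto intro: summable_mult summable_geometric\<close>)
qed

lemma norm_q_power_le_1: "norm (q * q ^ M * (q ^ r)\<^sup>2) \<le> 1" "norm ((q * q ^ M * (q ^ r)\<^sup>2)\<^sup>2) \<le> 1"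
proof -
  have "q * q ^ M * (q ^ r)\<^sup>2 = q ^ (1 + M + r * 2)"
    by (simp only: power_add power_mult power_one_right)
  then show "norm (q * q ^ M * (q ^ r)\<^sup>2) \<le> 1"
    using q by (simp only: norm_power) (intro power_le_one, auto)
  then show "norm ((q * q ^ M * (q ^ r)\<^sup>2)\<^sup>2) \<le> 1"
    unfolding norm_power[of _ 2] by (intro power_le_one) auto
qed

lemma summable_hw1: "summable (hw1 M)"
  unfolding hw1_def by (rule summable_hw) (auto intro!: norm_one_minus_le_2 norm_q_power_le_1)

lemma summable_hw2: "summable (hw2 M)"
  unfolding hw2_def by (rule summable_hw) (auto intro!: norm_one_minus_le_2 norm_q_power_le_1)

lemma power_choose_two_Suc: "q ^ (5 * (Suc r choose 2)) = q ^ (5 * (r choose 2)) * (q ^ r) ^ 5"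
proof -
  have "5 * (Suc r choose 2) = 5 * (r choose 2) + r * 5"
    by (simp add: numeral_2_eq_2)
  then show ?thesis by (simp only: power_add power_mult)
qed

lemma power_M_Suc: "(q ^ Suc M) ^ (2 * r) = (q ^ M) ^ (2 * r) * (q ^ r)\<^sup>2"
  by (simp add: power_mult_distrib power_mult[symmetric] mult.commute)

lemma qpoch_M_Suc: "qpoch q q (Suc M + r) = (1 - q * q ^ M * q ^ r) * qpoch q q (M + r)"
  by (simp add: qpoch_self_Suc power_add mult_ac)

text \<open>With \<open>x = q^r\<close> and \<open>a = q^(M+1)\<close>, write
  \<open>1 - a x\<^sup>2 = x (1 - a x) + (1 - x)\<close>. The factor \<open>1 - a x\<close> extends
  the q-factorial \<open>(q; q)_(M+r)\<close>, while \<open>1 - x\<close> cancels against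
  \<open>inv_qfact q r\<close> and allows an index shift.\<close>

lemma hw1_eq_hw2_Suc: "suminf (hw1 M) = suminf (hw2 (Suc M))"
proof -
  define A B where "A r = (-1) ^ r * q ^ (5 * (r choose 2)) * (q ^ r) ^ 5 * (q ^ M) ^ (2 * r) * 1 *
      qpoch q q (Suc M + r) * inv_qfact q r"
    and "B r = (-1) ^ r * q ^ (5 * (r choose 2)) * (q ^ r) ^ 4 * (q ^ M) ^ (2 * r) *
      qpoch q q (M + r) * ((1 - q ^ r) * inv_qfact q r)" for r
  have "hw1 M = (\<lambda>r. A r + B r)"
  proof
    fix r
    define x where "x = q ^ r"
    show "hw1 M r = A r + B r"
      unfolding hw1_def A_def B_def qpoch_M_Suc x_def[symmetric]
      by (simp add: algebra_simps power2_eq_square power4_eq_xxxx eval_nat_numeral)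
  qed
  then have "(\<lambda>r. A r + B r) sums suminf (hw1 M)"
    using summable_sums[OF summable_hw1[of M]] by metis
  moreover have "summable A"
    unfolding A_def by (rule summable_hw) auto
  ultimately have "(\<lambda>r. A r + B (Suc r)) sums suminf (hw1 M)"
    by (rule sums_shift_second) (simp add: B_def)
  moreover have "A r + B (Suc r) = hw2 (Suc M) r" for r
  proof -
    define x u v w where "x = q ^ r" and "u = q ^ (5 * (r choose 2))" and "v = (q ^ M) ^ (2 * r)"
      and "w = qpoch q q (Suc M + r)"
    have qS: "q ^ Suc r = q * x" by (simp add: x_def)
    have vS: "(q ^ M) ^ (2 * Suc r) = v * (q ^ M)\<^sup>2" by (simp add: v_def power2_eq_square mult_ac)
    have wS: "qpoch q q (M + Suc r) = w" by (simp add: w_def)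
    have "B (Suc r) = - ((-1) ^ r * (u * x ^ 5) * (q * x) ^ 4 * (v * (q ^ M)\<^sup>2) * w * inv_qfact q r)"
      unfolding B_def inv_qfact_Suc[OF q] power_choose_two_Suc vS wS unfolding qS x_def[symmetric] u_def[symmetric] by simp
    then show ?thesis
      unfolding A_def hw2_def power_M_Suc x_def[symmetric] u_def[symmetric] v_def[symmetric] w_def[symmetric]
      by (simp add: algebra_simps eval_nat_numeral)
  qed
  ultimately have "hw2 (Suc M) sums suminf (hw1 M)"
    by simp
  then show ?thesis by (simp add: sums_iff)
qed

text \<open>The same device, now with \<open>(1 - a\<^sup>2 x^4) - x (1 - a x\<^sup>2) = a x^3 (1 -
  a x) + (1 - x)\<close>.\<close>

lemma hw2_diff_hw1: "suminf (hw2 M) - suminf (hw1 M) = q ^ Suc M * suminf (hw1 (Suc M))"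
proof -
  define A B where "A r = (-1) ^ r * q ^ (5 * (r choose 2)) * (q ^ r) ^ 6 * (q ^ M) ^ (2 * r) * (q * q ^ M) *
      qpoch q q (Suc M + r) * inv_qfact q r"
    and "B r = (-1) ^ r * q ^ (5 * (r choose 2)) * (q ^ r) ^ 3 * (q ^ M) ^ (2 * r) *
      qpoch q q (M + r) * ((1 - q ^ r) * inv_qfact q r)" for r
  have "(\<lambda>r. hw2 M r - hw1 M r) = (\<lambda>r. A r + B r)"
  proof
    fix r
    define x where "x = q ^ r"
    show "hw2 M r - hw1 M r = A r + B r"
      unfolding hw1_def hw2_def A_def B_def qpoch_M_Suc x_def[symmetric]
      by (simp add: algebra_simps eval_nat_numeral)
  qed
  then have "(\<lambda>r. A r + B r) sums (suminf (hw2 M) - suminf (hw1 M))"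
    using sums_diff[OF summable_sums[OF summable_hw2[of M]] summable_sums[OF summable_hw1[of M]]] by simp
  moreover have "summable A"
  proof -
    have "norm (q * q ^ M) \<le> 2"
      using norm_q_power_le_1(1)[of M 0] by simp
    then show ?thesis
      unfolding A_def by (intro summable_hw) auto
  qed
  ultimately have "(\<lambda>r. A r + B (Suc r)) sums (suminf (hw2 M) - suminf (hw1 M))"
    by (rule sums_shift_second) (simp add: B_def)
  moreover have "A r + B (Suc r) = q ^ Suc M * hw1 (Suc M) r" for r
  proof -
    define x u v w where "x = q ^ r" and "u = q ^ (5 * (r choose 2))" and "v = (q ^ M) ^ (2 * r)"
      and "w = qpoch q q (Suc M + r)"
    have qS: "q ^ Suc r = q * x" by (simp add: x_def)
    have vS: "(q ^ M) ^ (2 * Suc r) = v * (q ^ M)\<^sup>2" by (simp add: v_def power2_eq_square mult_ac)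
    have wS: "qpoch q q (M + Suc r) = w" by (simp add: w_def)
    have "B (Suc r) = - ((-1) ^ r * (u * x ^ 5) * (q * x) ^ 3 * (v * (q ^ M)\<^sup>2) * w * inv_qfact q r)"
      unfolding B_def inv_qfact_Suc[OF q] power_choose_two_Suc vS wS unfolding qS x_def[symmetric] u_def[symmetric] by simp
    then show ?thesis
      unfolding A_def hw1_def power_M_Suc x_def[symmetric] u_def[symmetric] v_def[symmetric] w_def[symmetric]
      by (simp add: algebra_simps eval_nat_numeral)
  qed
  ultimately have "(\<lambda>r. q ^ Suc M * hw1 (Suc M) r) sums (suminf (hw2 M) - suminf (hw1 M))"
    by simp
  from sums_unique2[OF this sums_mult[OF summable_sums[OF summable_hw1]]] show ?thesis .
qed

lemma hw2_LIMSEQ: "(\<lambda>M. suminf (hw2 M)) \<longlonglongrightarrow> qpoch_inf q q"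
proof -
  \<comment> \<open>The termwise limit, with \<open>q^M\<close> replaced by 0;
    \<open>0 ^ (2 * r)\<close> leaves only the term \<open>r = 0\<close>. Tannery's theorem
    justifies the exchange of limits.\<close>
  define b where "b r = (-1) ^ r * q ^ (5 * (r choose 2)) * (q ^ r) ^ 3 * 0 ^ (2 * r) *
     (1 - (q * 0 * (q ^ r)\<^sup>2)\<^sup>2) * qpoch_inf q q * inv_qfact q r" for r
  obtain C where C: "\<And>k m r x M N. k > 0 \<Longrightarrow> norm x \<le> 2 \<Longrightarrow>
    norm ((-1) ^ r * q ^ m * (q ^ r) ^ k * (q ^ M) ^ (2 * r) * x * qpoch q q N * inv_qfact q r) \<le> C * norm q ^ r"
    using hw_bound by blast
  have "norm (hw2 M r) \<le> C * norm q ^ r" for M r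
    unfolding hw2_def by (rule C) (auto intro!: norm_one_minus_le_2 norm_q_power_le_1)
  moreover have "(\<lambda>M. hw2 M r) \<longlonglongrightarrow> b r" for r
    unfolding hw2_def b_def
    by (intro tendsto_intros LIMSEQ_power_zero q LIMSEQ_ignore_initial_segment[OF qpoch_LIMSEQ[OF q]])
  moreover have "summable (\<lambda>r. C * norm q ^ r)"
    using q by (intro summable_mult summable_geometric) auto
  ultimately have "(\<lambda>M. suminf (hw2 M)) \<longlonglongrightarrow> suminf b"
    using tannerys_theorem[of "\<lambda>r M. hw2 M r" b sequentially "\<lambda>r. C * norm q ^ r"]
    by (simp add: always_eventually)
  also have "suminf b = (\<Sum>r\<in>{0}. b r)"
    by (rule suminf_finite) (auto simp: b_def)
  also have "\<dots> = qpoch_inf q q"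
    by (simp add: b_def numeral_2_eq_2)
  finally show ?thesis .
qed

text \<open>Both sides solve the same recurrence and tend to 1, so their difference falls under
  \<open>rr_recurrence_unique\<close>.\<close>

lemma rr_series_eq_hw2: "rr_series q M = suminf (hw2 M) / qpoch_inf q q"
proof -
  define c where "c M = suminf (hw2 M) / qpoch_inf q q" for M
  have "suminf (hw2 M) = suminf (hw2 (Suc M)) + q ^ Suc M * suminf (hw2 (Suc (Suc M)))" for M
    using hw2_diff_hw1[of M] by (simp add: hw1_eq_hw2_Suc algebra_simps)
  then have c_rec: "c M = c (Suc M) + q ^ Suc M * c (Suc (Suc M))" for M
    unfolding c_def by (metis add_divide_distrib times_divide_eq_right)
  have "c \<longlonglongrightarrow> qpoch_inf q q / qpoch_inf q q"
    unfolding c_def by (intro tendsto_divide hw2_LIMSEQ tendsto_const qpoch_inf_nonzero q)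
  then have "c \<longlonglongrightarrow> 1"
    using qpoch_inf_nonzero[OF q q] by simp
  from tendsto_diff[OF rr_series_LIMSEQ this] have lim: "(\<lambda>M. rr_series q M - c M) \<longlonglongrightarrow> 0"
    by simp
  have "rr_series q M - c M = 0"
  proof (rule rr_recurrence_unique[OF q _ lim])
    show "rr_series q M - c M = rr_series q (Suc M) - c (Suc M) + q ^ Suc M * (rr_series q (Suc (Suc M)) - c (Suc (Suc M)))" for M
      by (subst rr_series_rec, subst c_rec) (simp add: algebra_simps)
  qed
  then show ?thesis by (simp add: c_def)
qed

section \<open>Product sides modulo 5\<close>

lemma norm_power_lt_1: "k > 0 \<Longrightarrow> norm (q ^ k) < 1"
  using q by (simp add: norm_power power_less_one_iff)

text \<open>The factors of the first \<open>5 n\<close> terms are sorted by exponent modulo 5 before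
  passing to the limit.\<close>

lemma qpoch_inf_split_5:
  "qpoch_inf q q = qpoch_inf q (q ^ 5) * qpoch_inf (q\<^sup>2) (q ^ 5) * qpoch_inf (q ^ 3) (q ^ 5) *
     qpoch_inf (q ^ 4) (q ^ 5) * qpoch_inf (q ^ 5) (q ^ 5)"
proof -
  have q5: "norm (q ^ 5) < 1" by (rule norm_power_lt_1) simp
  let ?P = "\<lambda>n. qpoch q (q ^ 5) n * qpoch (q\<^sup>2) (q ^ 5) n * qpoch (q ^ 3) (q ^ 5) n *
     qpoch (q ^ 4) (q ^ 5) n * qpoch (q ^ 5) (q ^ 5) n"
  have eq: "qpoch q q (n * 5) = ?P n" for n
  proof (induction n)
    case (Suc n)
    have "Suc n * 5 = Suc (Suc (Suc (Suc (Suc (n * 5)))))" by simp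
    then have "qpoch q q (Suc n * 5) = ?P n * (1 - q ^ Suc (n * 5)) * (1 - q ^ Suc (Suc (n * 5))) *
      (1 - q ^ Suc (Suc (Suc (n * 5)))) * (1 - q ^ Suc (Suc (Suc (Suc (n * 5))))) * (1 - q ^ Suc (Suc (Suc (Suc (Suc (n * 5))))))"
      by (simp only: qpoch_self_Suc Suc.IH)
    moreover have "q ^ (n * 5) = (q ^ 5) ^ n"
      by (simp add: power_mult[symmetric] mult.commute)
    ultimately show ?case
      by (simp add: qpoch_Suc eval_nat_numeral mult_ac)
  qed simp
  have "(\<lambda>n. qpoch q q (n * 5)) \<longlonglongrightarrow> qpoch_inf q q"
    using LIMSEQ_subseq_LIMSEQ[OF qpoch_LIMSEQ[OF q], of "\<lambda>n. n * 5"]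
    by (simp add: strict_mono_def o_def)
  moreover have "?P \<longlonglongrightarrow> qpoch_inf q (q ^ 5) * qpoch_inf (q\<^sup>2) (q ^ 5) * qpoch_inf (q ^ 3) (q ^ 5) *
     qpoch_inf (q ^ 4) (q ^ 5) * qpoch_inf (q ^ 5) (q ^ 5)"
    by (intro tendsto_intros qpoch_LIMSEQ q5)
  ultimately show ?thesis
    unfolding eq by (rule LIMSEQ_unique)
qed

lemma qpoch_inf_power_5_nonzero: "k > 0 \<Longrightarrow> qpoch_inf (q ^ k) (q ^ 5) \<noteq> 0"
  by (intro qpoch_inf_nonzero norm_power_lt_1) auto

lemma qpoch_mult_inv_qfact: "qpoch q q r * inv_qfact q r = 1"
  using qpoch_nonzero[OF q q] by (simp add: inv_qfact_def)

text \<open>At \<open>M = 0\<close> the q-factorials in \<open>hw2\<close> cancel, leaving the theta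
  series of the triple product with \<open>p = q^5\<close>, \<open>z = q^3\<close>,
  \<open>w = q\<^sup>2\<close>. The case \<open>q = 0\<close> is separate because the triple product
  needs a nonzero base.\<close>

lemma rogers_ramanujan_1:
  "rr_series q 0 = 1 / (qpoch_inf q (q ^ 5) * qpoch_inf (q ^ 4) (q ^ 5))"
proof (cases "q = 0")
  case True
  then show ?thesis
    unfolding rr_series_def by (subst suminf_finite[of "{0}"]) (auto simp: qpoch_inf_def)
next
  case False
  have "hw2 0 r = (-1) ^ r * (q ^ 5) ^ (r choose 2) * ((q ^ 3) ^ r - (q ^ 5) ^ r * (q\<^sup>2) ^ Suc r)" for r
  proof -
    define x where "x = q ^ r"
    have p: "(q ^ k) ^ r = x ^ k" for k by (simp add: x_def power_mult[symmetric] mult.commute)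
    have "hw2 0 r = (-1) ^ r * q ^ (5 * (r choose 2)) * x ^ 3 * (1 - (q * x\<^sup>2)\<^sup>2) * (qpoch q q r * inv_qfact q r)"
      by (simp add: hw2_def x_def mult_ac)
    then show ?thesis
      unfolding qpoch_mult_inv_qfact power_mult power_Suc p by (simp add: algebra_simps eval_nat_numeral)
  qed
  moreover have "((\<lambda>r. (-1) ^ r * (q ^ 5) ^ (r choose 2) * ((q ^ 3) ^ r - (q ^ 5) ^ r * (q\<^sup>2) ^ Suc r)) has_sum
      (qpoch_inf (q ^ 3) (q ^ 5) * qpoch_inf (q\<^sup>2) (q ^ 5) * qpoch_inf (q ^ 5) (q ^ 5))) UNIV"
    using False by (intro jacobi_triple_product norm_power_lt_1) (auto simp: power_add[symmetric])
  ultimately have "suminf (hw2 0) = qpoch_inf (q ^ 3) (q ^ 5) * qpoch_inf (q\<^sup>2) (q ^ 5) * qpoch_inf (q ^ 5) (q ^ 5)"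
    by (metis (no_types, lifting) has_sum_cong has_sum_imp_sums sums_unique)
  then show ?thesis
    using qpoch_inf_power_5_nonzero[of 2] qpoch_inf_power_5_nonzero[of 3] qpoch_inf_power_5_nonzero[of 5]
    by (simp add: rr_series_eq_hw2 qpoch_inf_split_5)
qed

text \<open>As before, with \<open>z = q^4\<close> and \<open>w = q\<close>: the theta series is now
  \<open>hw1 0\<close>, whose sum equals that of \<open>hw2 1\<close>.\<close>

lemma rogers_ramanujan_2:
  "rr_series q 1 = 1 / (qpoch_inf (q\<^sup>2) (q ^ 5) * qpoch_inf (q ^ 3) (q ^ 5))"
proof (cases "q = 0")
  case True
  then show ?thesis
    unfolding rr_series_def by (subst suminf_finite[of "{0}"]) (auto simp: qpoch_inf_def)
next
  case False
  have "hw1 0 r = (-1) ^ r * (q ^ 5) ^ (r choose 2) * ((q ^ 4) ^ r - (q ^ 5) ^ r * q ^ Suc r)" for r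
  proof -
    define x where "x = q ^ r"
    have p: "(q ^ k) ^ r = x ^ k" for k by (simp add: x_def power_mult[symmetric] mult.commute)
    have "hw1 0 r = (-1) ^ r * q ^ (5 * (r choose 2)) * x ^ 4 * (1 - q * x\<^sup>2) * (qpoch q q r * inv_qfact q r)"
      by (simp add: hw1_def x_def mult_ac)
    then show ?thesis
      unfolding qpoch_mult_inv_qfact power_mult power_Suc p x_def[symmetric] by (simp add: algebra_simps eval_nat_numeral)
  qed
  moreover have "((\<lambda>r. (-1) ^ r * (q ^ 5) ^ (r choose 2) * ((q ^ 4) ^ r - (q ^ 5) ^ r * q ^ Suc r)) has_sum
      (qpoch_inf (q ^ 4) (q ^ 5) * qpoch_inf q (q ^ 5) * qpoch_inf (q ^ 5) (q ^ 5))) UNIV"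
    using False q by (intro jacobi_triple_product norm_power_lt_1) (auto simp: power_Suc2[symmetric] simp del: power_Suc)
  ultimately have "suminf (hw1 0) = qpoch_inf (q ^ 4) (q ^ 5) * qpoch_inf q (q ^ 5) * qpoch_inf (q ^ 5) (q ^ 5)"
    by (metis (no_types, lifting) has_sum_cong has_sum_imp_sums sums_unique)
  then have "suminf (hw2 1) = qpoch_inf (q ^ 4) (q ^ 5) * qpoch_inf q (q ^ 5) * qpoch_inf (q ^ 5) (q ^ 5)"
    using hw1_eq_hw2_Suc[of 0] by simp
  then show ?thesis
    using qpoch_inf_power_5_nonzero[of 1] qpoch_inf_power_5_nonzero[of 4] qpoch_inf_power_5_nonzero[of 5]
    by (simp add: rr_series_eq_hw2 qpoch_inf_split_5)
qed

end

section \<open>The triple sums\<close>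

text \<open>The quadratic part of the exponent is
  \<open>(i+j)\<^sup>2 + (i+k)\<^sup>2 + j k\<close>; the parameters \<open>s\<close> and
  \<open>t\<close> add the linear terms that select \<open>G\<close> or \<open>H\<close> in each
  factor.\<close>

lemma triple_sum_eq_rr_product:
  assumes q: "norm q < 1"
  shows "((\<lambda>(i,j,k). q ^ (2*i^2 + j^2 + k^2 + 2*i*j + 2*i*k + j*k + s * (i + j) + t * (i + k))
        / (qpoch q q i * qpoch q q j * qpoch q q k))
      has_sum (rr_series q s * rr_series q t)) UNIV"
proof -
  define c where "c s n = q ^ n\<^sup>2 * (q ^ s) ^ n" for s n
  let ?X = "\<lambda>i j k. 2*i^2 + j^2 + k^2 + 2*i*j + 2*i*k + j*k + s * (i + j) + t * (i + k)"
  let ?g = "\<lambda>(i, j, k). q ^ ?X i j k * inv_qfact q i * inv_qfact q j * inv_qfact q k"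
  have "i + j + k \<le> ?X i j k" for i j k
  proof -
    have "i \<le> i\<^sup>2" "j \<le> j\<^sup>2" "k \<le> k\<^sup>2" by (simp_all add: power2_eq_square)
    then show ?thesis by linarith
  qed
  then have "?g summable_on UNIV"
    by (rule summable_on_triple_inv_qfact[OF q q])
  then have has: "(?g has_sum infsum ?g UNIV) UNIV"
    by (rule has_sum_infsum)
  have "?g = (\<lambda>(i, j, k). c s (i + j) * c t (i + k) * q ^ (j * k) *
      inv_qfact q i * inv_qfact q j * inv_qfact q k)"
  proof -
    have "?X i j k = (i + j)\<^sup>2 + s * (i + j) + ((i + k)\<^sup>2 + t * (i + k)) + j * k" for i j k
      by (simp add: power2_eq_square algebra_simps)
    then have "q ^ ?X i j k = c s (i + j) * c t (i + k) * q ^ (j * k)" for i j k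
      unfolding c_def by (simp only: power_add power_mult)
    then show ?thesis by (simp only:)
  qed
  with has have "((\<lambda>(i, j, k). c s (i + j) * c t (i + k) * q ^ (j * k) *
      inv_qfact q i * inv_qfact q j * inv_qfact q k) has_sum infsum ?g UNIV) UNIV"
    by metis
  from has_sum_regroup_pair[OF q this]
  have 1: "((\<lambda>(a, b). (c s a * inv_qfact q a) * (c t b * inv_qfact q b)) has_sum infsum ?g UNIV) UNIV" .
  have c: "c s n * inv_qfact q n = q ^ n\<^sup>2 * inv_qfact q n * (q ^ s) ^ n" for s n
    by (simp add: c_def mult_ac)
  have ns: "(\<lambda>n. norm (c s n * inv_qfact q n)) summable_on UNIV" for s
    unfolding c using rr_series_norm_summable[OF q]
    by (subst summable_on_UNIV_nonneg_real_iff) auto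
  have hs: "((\<lambda>n. c s n * inv_qfact q n) has_sum rr_series q s) UNIV" for s
    unfolding c by (rule rr_series_has_sum[OF q])
  from has_sum_times[OF ns ns hs hs]
  have "((\<lambda>(a, b). (c s a * inv_qfact q a) * (c t b * inv_qfact q b)) has_sum (rr_series q s * rr_series q t)) UNIV"
    by simp
  from has_sum_unique[OF 1 this] have "(?g has_sum (rr_series q s * rr_series q t)) UNIV"
    using has by simp
  then show ?thesis
    by (simp add: inv_qfact_def)
qed

text \<open>With \<open>n = j + k\<close> and \<open>N = 2 i + n\<close>, the exponent is
  \<open>N\<^sup>2 + s N + (n choose 2) + tri (k - j)\<close>, the shape required by
  \<open>has_sum_regroup_total\<close>.\<close>

lemma triple_sum_eq_rr_series:
  assumes q: "norm q < 1"
  shows "((\<lambda>(i,j,k). q ^ (4*i^2 + 2*j^2 + 2*k^2 + 4*i*j + 4*i*k + 2*j*k - j + s * (2*i + (j + k)))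
        / (qpoch (q^2) (q^2) i * qpoch (q^2) (q^2) j * qpoch (q^2) (q^2) k))
      has_sum rr_series q s) UNIV"
proof -
  define c where "c n = q ^ n\<^sup>2 * (q ^ s) ^ n" for n
  have q2: "norm (q\<^sup>2) < 1"
    using q by (simp add: norm_power power_less_one_iff)
  let ?X = "\<lambda>i j k. 4*i^2 + 2*j^2 + 2*k^2 + 4*i*j + 4*i*k + 2*j*k - j + s * (2*i + (j + k))"
  let ?g = "\<lambda>(i, j, k). q ^ ?X i j k * inv_qfact (q\<^sup>2) i * inv_qfact (q\<^sup>2) j * inv_qfact (q\<^sup>2) k"
  have le: "i \<le> i\<^sup>2" for i :: nat by (simp add: power2_eq_square)
  have "i + j + k \<le> ?X i j k" for i j k
    using le[of i] le[of j] le[of k] by linarith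
  then have "?g summable_on UNIV"
    by (rule summable_on_triple_inv_qfact[OF q q2])
  then have has: "(?g has_sum infsum ?g UNIV) UNIV"
    by (rule has_sum_infsum)
  have "?g = (\<lambda>(i, j, k). c (2 * i + (j + k)) * q ^ ((j + k) choose 2) * q ^ tri (int k - int j) *
            inv_qfact (q\<^sup>2) i * inv_qfact (q\<^sup>2) j * inv_qfact (q\<^sup>2) k)"
  proof -
    have "?X i j k = (2 * i + (j + k))\<^sup>2 + s * (2 * i + (j + k)) + ((j + k) choose 2) + tri (int k - int j)" for i j k
    proof -
      \<comment> \<open>The subtracted \<open>j\<close> is moved to the other side, and the identity
        is checked over the integers, to avoid truncated subtraction.\<close>
      have "int (4*i^2 + 2*j^2 + 2*k^2 + 4*i*j + 4*i*k + 2*j*k) =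
          int ((2 * i + (j + k))\<^sup>2 + ((j + k) choose 2) + tri (int k - int j) + j)"
        using tri_double[of "int (j + k) - 1"] tri_double[of "int k - int j"]
        unfolding tri_pred_of_nat by (simp add: power2_eq_square algebra_simps)
      then have "4*i^2 + 2*j^2 + 2*k^2 + 4*i*j + 4*i*k + 2*j*k =
          (2 * i + (j + k))\<^sup>2 + ((j + k) choose 2) + tri (int k - int j) + j"
        by (simp only: of_nat_eq_iff)
      then show ?thesis by simp
    qed
    then have "q ^ ?X i j k = c (2 * i + (j + k)) * q ^ ((j + k) choose 2) * q ^ tri (int k - int j)" for i j k
      unfolding c_def by (simp only: power_add power_mult)
    then show ?thesis by (simp only:)
  qed
  with has have "((\<lambda>(i, j, k). c (2 * i + (j + k)) * q ^ ((j + k) choose 2) * q ^ tri (int k - int j) *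
            inv_qfact (q\<^sup>2) i * inv_qfact (q\<^sup>2) j * inv_qfact (q\<^sup>2) k) has_sum infsum ?g UNIV) UNIV"
    by metis
  from has_sum_regroup_total[OF q this]
  have 1: "((\<lambda>n. c n * inv_qfact q n) has_sum infsum ?g UNIV) UNIV" .
  have "((\<lambda>n. c n * inv_qfact q n) has_sum rr_series q s) UNIV"
    using rr_series_has_sum[OF q, of s] by (simp add: c_def mult_ac)
  from has_sum_unique[OF 1 this] have "(?g has_sum rr_series q s) UNIV"
    using has by simp
  then show ?thesis
    by (simp add: inv_qfact_def)
qed

theorem theorem4p11:
  fixes q :: complex
  assumes "norm q < 1"
  shows
   "((\<lambda>(i,j,k). q ^ (4*i^2 + 2*j^2 + 2*k^2 + 4*i*j + 4*i*k + 2*j*k - j)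
        / (qpoch (q^2) (q^2) i * qpoch (q^2) (q^2) j * qpoch (q^2) (q^2) k))
      has_sum (1 / (qpoch_inf q (q^5) * qpoch_inf (q^4) (q^5)))) (UNIV :: (nat \<times> nat \<times> nat) set)
  \<and> ((\<lambda>(i,j,k). q ^ (2*i^2 + j^2 + k^2 + 2*i*j + 2*i*k + j*k)
        / (qpoch q q i * qpoch q q j * qpoch q q k))
      has_sum (1 / (qpoch_inf q (q^5) * qpoch_inf (q^4) (q^5)) ^ 2)) (UNIV :: (nat \<times> nat \<times> nat) set)
  \<and> ((\<lambda>(i,j,k). q ^ (4*i^2 + 2*j^2 + 2*k^2 + 4*i*j + 4*i*k + 2*j*k + 2*i + j)
        / (qpoch (q^2) (q^2) i * qpoch (q^2) (q^2) j * qpoch (q^2) (q^2) k))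
      has_sum (1 / (qpoch_inf (q^2) (q^5) * qpoch_inf (q^3) (q^5)))) (UNIV :: (nat \<times> nat \<times> nat) set)
  \<and> ((\<lambda>(i,j,k). q ^ (2*i^2 + j^2 + k^2 + 2*i*j + 2*i*k + j*k + i + j)
        / (qpoch q q i * qpoch q q j * qpoch q q k))
      has_sum (qpoch_inf (q^5) (q^5) / qpoch_inf q q)) (UNIV :: (nat \<times> nat \<times> nat) set)
  \<and> ((\<lambda>(i,j,k). q ^ (2*i^2 + j^2 + k^2 + 2*i*j + 2*i*k + j*k + 2*i + j + k)
        / (qpoch q q i * qpoch q q j * qpoch q q k))
      has_sum (1 / (qpoch_inf (q^2) (q^5) * qpoch_inf (q^3) (q^5)) ^ 2)) (UNIV :: (nat \<times> nat \<times> nat) set)"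
proof (intro conjI, goal_cases)
  case 1
  show ?case
    using triple_sum_eq_rr_series[OF assms, of 0] by (simp add: rogers_ramanujan_1[OF assms])
next
  case 2
  show ?case
    using triple_sum_eq_rr_product[OF assms, of 0 0] rogers_ramanujan_1[OF assms]
    by (simp add: power2_eq_square)
next
  case 3
  \<comment> \<open>For \<open>s = 1\<close> the linear part is \<open>2 i + k\<close>, while
    \<open>2 i + j\<close> is wanted; the symmetry exchanging \<open>j\<close> and \<open>k\<close>
    repairs this.\<close>
  have X: "4*i^2 + 2*k^2 + 2*j^2 + 4*i*k + 4*i*j + 2*k*j - k + 1 * (2*i + (k + j)) =
      4*i^2 + 2*j^2 + 2*k^2 + 4*i*j + 4*i*k + 2*j*k + 2*i + j" for i j k :: nat
  proof -
    have "k \<le> k\<^sup>2" by (simp add: power2_eq_square)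
    then have "k \<le> 4*i^2 + 2*k^2 + 2*j^2 + 4*i*k + 4*i*j + 2*k*j" by linarith
    then have "4*i^2 + 2*k^2 + 2*j^2 + 4*i*k + 4*i*j + 2*k*j - k + 1 * (2*i + (k + j)) =
        4*i^2 + 2*k^2 + 2*j^2 + 4*i*k + 4*i*j + 2*k*j + 2*i + j"
      by simp
    then show ?thesis by (simp add: algebra_simps)
  qed
  have "bij_betw (\<lambda>(i, j, k). (i, k, j)) UNIV (UNIV :: (nat \<times> nat \<times> nat) set)"
    by (rule bij_betwI[of _ _ _ "\<lambda>(i, j, k). (i, k, j)"]) auto
  from iffD2[OF has_sum_reindex_bij_betw[OF this] triple_sum_eq_rr_series[OF assms, of 1]]
  show ?case
    unfolding rogers_ramanujan_2[OF assms] case_prod_unfold fst_conv snd_conv X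
    by (simp only: mult_ac)
next
  case 4
  \<comment> \<open>In \<open>G H\<close> the four residue classes 1 to 4 modulo 5 make up
    \<open>(q; q)_\<infinity>\<close> without its multiples of 5.\<close>
  have "qpoch_inf (q^5) (q^5) / qpoch_inf q q = rr_series q 1 * rr_series q 0"
    using qpoch_inf_power_5_nonzero[OF assms, of 5]
    unfolding rogers_ramanujan_1[OF assms] rogers_ramanujan_2[OF assms] qpoch_inf_split_5[OF assms]
    by simp
  then show ?case
    using triple_sum_eq_rr_product[OF assms, of 1 0] by (simp add: add.assoc)
next
  case 5
  have X: "2*i^2 + j^2 + k^2 + 2*i*j + 2*i*k + j*k + 1 * (i + j) + 1 * (i + k) =
     2*i^2 + j^2 + k^2 + 2*i*j + 2*i*k + j*k + 2*i + j + k" for i j k :: nat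
    by simp
  show ?case
    using triple_sum_eq_rr_product[OF assms, of 1 1] unfolding X rogers_ramanujan_2[OF assms]
    by (simp add: power2_eq_square)
qed

end
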